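(* Let $G=(V,E)$ be a uniformly locally finite simple undirected graph and let $v_i\in V$ have degree $d_i$. Then $$\frac{d_i^{3/2}}{M_4(G,i)^{1/2}}\le\mathcal{E}_G(v_i)\le\sqrt{d_i}.$$
   Context: A graph $G=(V,E)$ (countable vertex set) is uniformly locally finite if $\sup_{v\in V}\deg(v)<\infty$. Its adjacency operator $A$ on $\ell^2(V)$ is defined by $A\delta_x=\sum_{x'\sim x}\delta_{x'}$, where $\{\delta_x\}_{x\in V}$ is the standard orthonormal basis; it is a bounded self-adjoint operator. Let $|A|=(AA^* )^{1/2}$. The energy of the vertex $v$ is $\mathcal{E}_G(v)=\langle |A|\delta_v,\delta_v\rangle$. $M_4(G,i)=\langle A^4\delta_{v_i},\delta_{v_i}\rangle$, the number of closed walks of length $4$ starting and ending at $v_i$. *)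

theory Defs
  imports "HOL-Analysis.Analysis"
begin

section \<open>Graphs\<close>

text \<open>The vertex set is a set \<open>V\<close>, and an edge is the two-element set of its end points.\<close>

definition simple_graph :: "'a set \<Rightarrow> 'a set set \<Rightarrow> bool" where
  "simple_graph V E \<longleftrightarrow> (\<forall>e\<in>E. e \<subseteq> V \<and> card e = 2)"

definition neighbours :: "'a set set \<Rightarrow> 'a \<Rightarrow> 'a set" where
  "neighbours E x = {y. {x, y} \<in> E}"

definition vertex_degree :: "'a set set \<Rightarrow> 'a \<Rightarrow> nat" where
  "vertex_degree E x = card (neighbours E x)"

text \<open>Finiteness is required separately, because \<open>card\<close> is \<open>0\<close> on infinite sets.\<close>

definition uniformly_locally_finite :: "'a set \<Rightarrow> 'a set set \<Rightarrow> bool" where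
  "uniformly_locally_finite V E \<longleftrightarrow>
     (\<exists>K. \<forall>x\<in>V. finite (neighbours E x) \<and> vertex_degree E x \<le> K)"


section \<open>The complex Hilbert space of square-summable functions\<close>

text \<open>A function on \<open>V\<close> is represented by its extension by \<open>0\<close> to the whole type.\<close>

definition ell2 :: "'a set \<Rightarrow> ('a \<Rightarrow> complex) set" where
  "ell2 V = {f. (\<forall>x. x \<notin> V \<longrightarrow> f x = 0) \<and> (\<lambda>x. (cmod (f x))\<^sup>2) summable_on V}"

definition ell2_inner :: "'a set \<Rightarrow> ('a \<Rightarrow> complex) \<Rightarrow> ('a \<Rightarrow> complex) \<Rightarrow> complex" where
  "ell2_inner V f g = (\<Sum>\<^sub>\<infinity>x\<in>V. f x * cnj (g x))"

definition ell2_norm :: "'a set \<Rightarrow> ('a \<Rightarrow> complex) \<Rightarrow> real" where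
  "ell2_norm V f = sqrt (\<Sum>\<^sub>\<infinity>x\<in>V. (cmod (f x))\<^sup>2)"

definition delta :: "'a \<Rightarrow> 'a \<Rightarrow> complex" where
  "delta x = (\<lambda>y. if y = x then 1 else 0)"


section \<open>Bounded operators\<close>

text \<open>
  Operators are extensional functions (\<open>undefined\<close> outside \<open>ell2 V\<close>), so that equality of
  HOL functions is equality of operators and the definite descriptions below are meaningful.
\<close>

definition bounded_op :: "'a set \<Rightarrow> (('a \<Rightarrow> complex) \<Rightarrow> ('a \<Rightarrow> complex)) \<Rightarrow> bool" where
  "bounded_op V T \<longleftrightarrow>
     T \<in> ell2 V \<rightarrow>\<^sub>E ell2 V \<and>
     (\<forall>f\<in>ell2 V. \<forall>g\<in>ell2 V. T (\<lambda>x. f x + g x) = (\<lambda>x. T f x + T g x)) \<and>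
     (\<forall>c. \<forall>f\<in>ell2 V. T (\<lambda>x. c * f x) = (\<lambda>x. c * T f x)) \<and>
     (\<exists>K. \<forall>f\<in>ell2 V. ell2_norm V (T f) \<le> K * ell2_norm V f)"

definition adjoint_op ::
  "'a set \<Rightarrow> (('a \<Rightarrow> complex) \<Rightarrow> ('a \<Rightarrow> complex)) \<Rightarrow> (('a \<Rightarrow> complex) \<Rightarrow> ('a \<Rightarrow> complex))" where
  "adjoint_op V T =
     (THE S. bounded_op V S \<and>
        (\<forall>f\<in>ell2 V. \<forall>g\<in>ell2 V. ell2_inner V (T f) g = ell2_inner V f (S g)))"

definition positive_op :: "'a set \<Rightarrow> (('a \<Rightarrow> complex) \<Rightarrow> ('a \<Rightarrow> complex)) \<Rightarrow> bool" where
  "positive_op V T \<longleftrightarrow>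
     bounded_op V T \<and> (\<forall>f\<in>ell2 V. ell2_inner V (T f) f \<in> \<real>\<^sub>\<ge>\<^sub>0)"

definition sqrt_op ::
  "'a set \<Rightarrow> (('a \<Rightarrow> complex) \<Rightarrow> ('a \<Rightarrow> complex)) \<Rightarrow> (('a \<Rightarrow> complex) \<Rightarrow> ('a \<Rightarrow> complex))" where
  "sqrt_op V T = (THE S. positive_op V S \<and> compose (ell2 V) S S = T)"

definition abs_op ::
  "'a set \<Rightarrow> (('a \<Rightarrow> complex) \<Rightarrow> ('a \<Rightarrow> complex)) \<Rightarrow> (('a \<Rightarrow> complex) \<Rightarrow> ('a \<Rightarrow> complex))" where
  "abs_op V T = sqrt_op V (compose (ell2 V) T (adjoint_op V T))"


section \<open>Adjacency operator, vertex energy and fourth moment\<close>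

text \<open>The bounded operator determined by its values on the orthonormal basis.\<close>

definition adjacency_op ::
  "'a set \<Rightarrow> 'a set set \<Rightarrow> (('a \<Rightarrow> complex) \<Rightarrow> ('a \<Rightarrow> complex))" where
  "adjacency_op V E =
     (THE A. bounded_op V A \<and>
        (\<forall>x\<in>V. A (delta x) = (\<lambda>y. \<Sum>x'\<in>neighbours E x. delta x' y)))"

text \<open>
  Both inner products below are real numbers, since \<open>|A|\<close> and \<open>A\<close> are self-adjoint;
  \<open>Re\<close> merely converts them to type \<open>real\<close>.
\<close>

definition vertex_energy :: "'a set \<Rightarrow> 'a set set \<Rightarrow> 'a \<Rightarrow> real" where
  "vertex_energy V E v =
     Re (ell2_inner V (abs_op V (adjacency_op V E) (delta v)) (delta v))"

definition M4 :: "'a set \<Rightarrow> 'a set set \<Rightarrow> 'a \<Rightarrow> real" where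
  "M4 V E v = Re (ell2_inner V ((adjacency_op V E ^^ 4) (delta v)) (delta v))"

end

theory Submission imports Defs begin

text \<open>
  Let \<open>S = |A|\<close> and \<open>m\<^sub>k = \<langle>S\<^sup>k \<delta>\<^sub>v, \<delta>\<^sub>v\<rangle>\<close>, so that \<open>m\<^sub>1\<close> is the energy, \<open>m\<^sub>2\<close> the degree and
  \<open>m\<^sub>4\<close> the fourth moment. Cauchy-Schwarz gives the upper bound \<open>m\<^sub>1\<^sup>2 \<le> m\<^sub>2\<close>. For the lower bound,
  Cauchy-Schwarz for the form \<open>\<langle>S f, g\<rangle>\<close> gives \<open>m\<^sub>2\<^sup>2 \<le> m\<^sub>1 m\<^sub>3\<close>, and \<open>m\<^sub>3\<^sup>2 \<le> m\<^sub>2 m\<^sub>4\<close>.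
  The square root of a positive operator is obtained by scaling it to \<open>1 - B\<close> with \<open>B\<close> a symmetric
  contraction and summing the binomial series of \<open>sqrt (1 - x)\<close> at \<open>B\<close>; its coefficients
  are absolutely summable. Pointwise limits of bounded sequences replace completeness.
\<close>

section \<open>Square-summable functions\<close>

lemma ell2_outside: "f \<in> ell2 V \<Longrightarrow> x \<notin> V \<Longrightarrow> f x = 0"
  by (simp add: ell2_def)

lemma ell2_summable: "f \<in> ell2 V \<Longrightarrow> (\<lambda>x. (cmod (f x))\<^sup>2) summable_on V"
  by (simp add: ell2_def)

lemma ell2_zero [simp]: "(\<lambda>x. 0) \<in> ell2 V"
  by (simp add: ell2_def)

lemma ell2_add [simp]:
  assumes "f \<in> ell2 V" "g \<in> ell2 V"
  shows "(\<lambda>x. f x + g x) \<in> ell2 V"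
proof -
  have "(\<lambda>x. (cmod (f x + g x))\<^sup>2) summable_on V"
  proof (rule summable_on_comparison_test)
    show "(\<lambda>x. 2 * (cmod (f x))\<^sup>2 + 2 * (cmod (g x))\<^sup>2) summable_on V"
      by (intro summable_on_add summable_on_cmult_right ell2_summable assms)
    show "(cmod (f x + g x))\<^sup>2 \<le> 2 * (cmod (f x))\<^sup>2 + 2 * (cmod (g x))\<^sup>2" for x
    proof -
      have "(cmod (f x + g x))\<^sup>2 \<le> (cmod (f x) + cmod (g x))\<^sup>2"
        by (intro power_mono norm_triangle_ineq) auto
      also have "\<dots> \<le> 2 * (cmod (f x))\<^sup>2 + 2 * (cmod (g x))\<^sup>2"
        using sum_squares_bound[of "cmod (f x)" "cmod (g x)"] by (simp add: power2_sum)
      finally show ?thesis .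
    qed
  qed auto
  then show ?thesis
    using assms by (simp add: ell2_def)
qed

lemma ell2_scale [simp]:
  assumes "f \<in> ell2 V"
  shows "(\<lambda>x. c * f x) \<in> ell2 V"
  using assms by (auto simp: ell2_def norm_mult power_mult_distrib intro!: summable_on_cmult_right)

lemma ell2_diff [simp]:
  assumes "f \<in> ell2 V" "g \<in> ell2 V"
  shows "(\<lambda>x. f x - g x) \<in> ell2 V"
  using ell2_add[OF assms(1) ell2_scale[OF assms(2), of "-1"]] by simp

lemma ell2_sum [simp]:
  assumes "\<And>i. i \<in> I \<Longrightarrow> u i \<in> ell2 V"
  shows "(\<lambda>x. \<Sum>i\<in>I. u i x) \<in> ell2 V"
  using assms by (induction I rule: infinite_finite_induct) auto

lemma ell2_finite_support:
  assumes "finite F" "F \<subseteq> V" "\<And>x. x \<notin> F \<Longrightarrow> f x = 0"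
  shows "f \<in> ell2 V"
proof -
  have "(\<lambda>x. (cmod (f x))\<^sup>2) summable_on V \<longleftrightarrow> (\<lambda>x. (cmod (f x))\<^sup>2) summable_on F"
    by (rule summable_on_cong_neutral) (use assms in auto)
  then show ?thesis
    using assms by (auto simp: ell2_def)
qed

lemma delta_in_ell2 [simp]: "x \<in> V \<Longrightarrow> delta x \<in> ell2 V"
  by (rule ell2_finite_support[of "{x}"]) (auto simp: delta_def)

section \<open>Inner product and norm\<close>

lemma ell2_inner_summable:
  assumes "f \<in> ell2 V" "g \<in> ell2 V"
  shows "(\<lambda>x. f x * cnj (g x)) summable_on V"
proof -
  have "(\<lambda>x. norm (f x * cnj (g x))) summable_on V"
  proof (rule Infinite_Sum.abs_summable_on_comparison_test')
    show "(\<lambda>x. (cmod (f x))\<^sup>2 + (cmod (g x))\<^sup>2) summable_on V"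
      by (intro summable_on_add ell2_summable assms)
    show "norm (f x * cnj (g x)) \<le> (cmod (f x))\<^sup>2 + (cmod (g x))\<^sup>2" for x
    proof -
      have "norm (f x * cnj (g x)) \<le> 2 * cmod (f x) * cmod (g x)"
        by (simp add: norm_mult)
      also have "\<dots> \<le> (cmod (f x))\<^sup>2 + (cmod (g x))\<^sup>2"
        by (rule sum_squares_bound)
      finally show ?thesis .
    qed
  qed
  then show ?thesis
    by (rule abs_summable_summable)
qed

lemma ell2_inner_add_left:
  assumes "f \<in> ell2 V" "g \<in> ell2 V" "h \<in> ell2 V"
  shows "ell2_inner V (\<lambda>x. f x + g x) h = ell2_inner V f h + ell2_inner V g h"
  unfolding ell2_inner_def
  by (simp add: distrib_right infsum_add[OF ell2_inner_summable ell2_inner_summable] assms)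

lemma ell2_inner_scale_left:
  assumes "f \<in> ell2 V" "h \<in> ell2 V"
  shows "ell2_inner V (\<lambda>x. c * f x) h = c * ell2_inner V f h"
  unfolding ell2_inner_def
  by (simp add: mult.assoc infsum_cmult_right[OF ell2_inner_summable] assms)

lemma ell2_inner_commute: "ell2_inner V g f = cnj (ell2_inner V f g)"
  unfolding ell2_inner_def by (subst infsum_cnj[symmetric]) (simp add: mult.commute)

lemma ell2_inner_diff_left:
  assumes "f \<in> ell2 V" "g \<in> ell2 V" "h \<in> ell2 V"
  shows "ell2_inner V (\<lambda>x. f x - g x) h = ell2_inner V f h - ell2_inner V g h"
  using ell2_inner_add_left[OF assms(1) ell2_scale[OF assms(2), of "-1"] assms(3)]
    ell2_inner_scale_left[OF assms(2,3), of "-1"] by simp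

lemma ell2_inner_add_right:
  assumes "f \<in> ell2 V" "g \<in> ell2 V" "h \<in> ell2 V"
  shows "ell2_inner V h (\<lambda>x. f x + g x) = ell2_inner V h f + ell2_inner V h g"
  using assms by (subst (1 2 3) ell2_inner_commute) (simp add: ell2_inner_add_left)

lemma ell2_inner_scale_right:
  assumes "f \<in> ell2 V" "h \<in> ell2 V"
  shows "ell2_inner V h (\<lambda>x. c * f x) = cnj c * ell2_inner V h f"
  using assms by (subst (1 2) ell2_inner_commute) (simp add: ell2_inner_scale_left)

lemma ell2_inner_diff_right:
  assumes "f \<in> ell2 V" "g \<in> ell2 V" "h \<in> ell2 V"
  shows "ell2_inner V h (\<lambda>x. f x - g x) = ell2_inner V h f - ell2_inner V h g"
  using assms by (subst (1 2 3) ell2_inner_commute) (simp add: ell2_inner_diff_left)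

lemmas ell2_inner_simps =
  ell2_inner_add_left ell2_inner_add_right ell2_inner_diff_left ell2_inner_diff_right
  ell2_inner_scale_left ell2_inner_scale_right

lemma ell2_norm_nonneg [simp]: "0 \<le> ell2_norm V f"
  by (simp add: ell2_norm_def infsum_nonneg)

lemma ell2_norm_zero [simp]: "ell2_norm V (\<lambda>x. 0) = 0"
  by (simp add: ell2_norm_def)

lemma ell2_norm_power2: "(ell2_norm V f)\<^sup>2 = (\<Sum>\<^sub>\<infinity>x\<in>V. (cmod (f x))\<^sup>2)"
  by (simp add: ell2_norm_def infsum_nonneg)

lemma ell2_inner_self:
  assumes "f \<in> ell2 V"
  shows "ell2_inner V f f = of_real ((ell2_norm V f)\<^sup>2)"
  unfolding ell2_norm_power2 ell2_inner_def complex_norm_square[symmetric]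
  by (intro infsumI has_sum_of_real has_sum_infsum ell2_summable assms)

text \<open>One value is a single summand of the squared norm. This makes norm convergence imply
  pointwise convergence and gives pointwise bounds for series of functions.\<close>

lemma cmod_le_ell2_norm:
  assumes "f \<in> ell2 V"
  shows "cmod (f x) \<le> ell2_norm V f"
proof (cases "x \<in> V")
  case True
  have "(\<Sum>y\<in>{x}. (cmod (f y))\<^sup>2) \<le> (\<Sum>\<^sub>\<infinity>y\<in>V. (cmod (f y))\<^sup>2)"
    by (rule finite_sum_le_infsum) (use True ell2_summable[OF assms] in auto)
  then show ?thesis
    by (simp add: ell2_norm_def real_le_rsqrt)
qed (use ell2_outside[OF assms] in simp)

lemma ell2_norm_eq_0D:
  assumes "f \<in> ell2 V" "ell2_norm V f = 0"
  shows "f = (\<lambda>x. 0)"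
  using cmod_le_ell2_norm[OF assms(1)] assms(2) by auto

lemma ell2_eqI:
  assumes "f \<in> ell2 V" "g \<in> ell2 V" "ell2_norm V (\<lambda>x. f x - g x) = 0"
  shows "f = g"
proof
  show "f x = g x" for x
    using fun_cong[OF ell2_norm_eq_0D[OF ell2_diff[OF assms(1,2)] assms(3)], of x] by simp
qed

lemma ell2_norm_scale:
  assumes "f \<in> ell2 V"
  shows "ell2_norm V (\<lambda>x. c * f x) = cmod c * ell2_norm V f"
  by (simp add: ell2_norm_def norm_mult power_mult_distrib infsum_cmult_right' real_sqrt_mult)

lemma ell2_norm_minus_commute: "ell2_norm V (\<lambda>x. f x - g x) = ell2_norm V (\<lambda>x. g x - f x)"
  by (simp add: ell2_norm_def norm_minus_commute)

section \<open>Bounded and positive operators\<close>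

lemma bounded_op_in: "bounded_op V T \<Longrightarrow> f \<in> ell2 V \<Longrightarrow> T f \<in> ell2 V"
  by (auto simp: bounded_op_def)

lemma bounded_op_add:
  "bounded_op V T \<Longrightarrow> f \<in> ell2 V \<Longrightarrow> g \<in> ell2 V \<Longrightarrow> T (\<lambda>x. f x + g x) = (\<lambda>x. T f x + T g x)"
  by (auto simp: bounded_op_def)

lemma bounded_op_scale:
  "bounded_op V T \<Longrightarrow> f \<in> ell2 V \<Longrightarrow> T (\<lambda>x. c * f x) = (\<lambda>x. c * T f x)"
  by (auto simp: bounded_op_def)

lemma bounded_op_diff:
  assumes "bounded_op V T" "f \<in> ell2 V" "g \<in> ell2 V"
  shows "T (\<lambda>x. f x - g x) = (\<lambda>x. T f x - T g x)"
  using bounded_op_add[OF assms(1,2) ell2_scale[OF assms(3), of "-1"]]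
    bounded_op_scale[OF assms(1,3), of "-1"] by simp

lemma bounded_op_zero: "bounded_op V T \<Longrightarrow> T (\<lambda>x. 0) = (\<lambda>x. 0)"
  using bounded_op_scale[of V T "\<lambda>x. 0" 0] by simp

lemma bounded_op_sum:
  assumes "bounded_op V T" "\<And>i. i \<in> I \<Longrightarrow> u i \<in> ell2 V"
  shows "T (\<lambda>x. \<Sum>i\<in>I. u i x) = (\<lambda>x. \<Sum>i\<in>I. T (u i) x)"
  using assms(2)
  by (induction I rule: infinite_finite_induct) (auto simp: bounded_op_zero[OF assms(1)] bounded_op_add[OF assms(1)])

text \<open>Passing from \<open>K\<close> to \<open>\<bar>K\<bar> + 1\<close> makes the bound
  strictly positive, even for the zero operator, so that one may divide by it.\<close>

lemma bounded_op_bound: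
  assumes "bounded_op V T"
  obtains K where "0 < K" "\<And>f. f \<in> ell2 V \<Longrightarrow> ell2_norm V (T f) \<le> K * ell2_norm V f"
proof -
  obtain K where K: "\<And>f. f \<in> ell2 V \<Longrightarrow> ell2_norm V (T f) \<le> K * ell2_norm V f"
    using assms unfolding bounded_op_def by blast
  have "ell2_norm V (T f) \<le> (\<bar>K\<bar> + 1) * ell2_norm V f" if "f \<in> ell2 V" for f
    by (rule order_trans[OF K[OF that]]) (intro mult_right_mono; simp)
  then show thesis
    by (intro that[of "\<bar>K\<bar> + 1"]) auto
qed

lemma bounded_opI:
  assumes "\<And>f. f \<in> ell2 V \<Longrightarrow> T f \<in> ell2 V"
    and "\<And>f g. f \<in> ell2 V \<Longrightarrow> g \<in> ell2 V \<Longrightarrow> T (\<lambda>x. f x + g x) = (\<lambda>x. T f x + T g x)"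
    and "\<And>c f. f \<in> ell2 V \<Longrightarrow> T (\<lambda>x. c * f x) = (\<lambda>x. c * T f x)"
    and "\<And>f. f \<in> ell2 V \<Longrightarrow> ell2_norm V (T f) \<le> K * ell2_norm V f"
  shows "bounded_op V (restrict T (ell2 V))"
  unfolding bounded_op_def using assms by (auto intro: exI[of _ K])

text \<open>Both operators are \<open>undefined\<close> off \<open>ell2 V\<close>, so agreement on
  \<open>ell2 V\<close> is equality of HOL functions. The uniqueness parts of the definite
  descriptions rest on this.\<close>

lemma bounded_op_eqI:
  assumes "bounded_op V S" "bounded_op V T" "\<And>f. f \<in> ell2 V \<Longrightarrow> S f = T f"
  shows "S = T"
  using assms by (intro PiE_ext[of S "ell2 V" "\<lambda>_. ell2 V" T]) (auto simp: bounded_op_def)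

lemma bounded_op_compose:
  assumes "bounded_op V S" "bounded_op V T"
  shows "bounded_op V (compose (ell2 V) S T)"
proof -
  obtain K where K: "0 < K" "\<And>f. f \<in> ell2 V \<Longrightarrow> ell2_norm V (S f) \<le> K * ell2_norm V f"
    using bounded_op_bound[OF assms(1)] by blast
  obtain L where L: "0 < L" "\<And>f. f \<in> ell2 V \<Longrightarrow> ell2_norm V (T f) \<le> L * ell2_norm V f"
    using bounded_op_bound[OF assms(2)] by blast
  have "ell2_norm V (S (T f)) \<le> (K * L) * ell2_norm V f" if "f \<in> ell2 V" for f
    using order_trans[OF K(2)[OF bounded_op_in[OF assms(2) that]] mult_left_mono[OF L(2)[OF that]]] K(1)
    by (simp add: mult.assoc)
  then show ?thesis
    unfolding compose_def using assms
    by (intro bounded_opI) (auto simp: bounded_op_in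
        bounded_op_add[OF assms(1)] bounded_op_scale[OF assms(1)]
        bounded_op_add[OF assms(2)] bounded_op_scale[OF assms(2)])
qed

section \<open>Symmetric and positive operators\<close>

text \<open>Self-adjointness stated directly through the inner product, so that it can be
  established before anything is known about the definite description in
  \<open>adjoint_op\<close>.\<close>

definition symmetric_op :: "'a set \<Rightarrow> (('a \<Rightarrow> complex) \<Rightarrow> ('a \<Rightarrow> complex)) \<Rightarrow> bool" where
  "symmetric_op V T \<longleftrightarrow> bounded_op V T \<and>
     (\<forall>f\<in>ell2 V. \<forall>g\<in>ell2 V. ell2_inner V (T f) g = ell2_inner V f (T g))"

lemma symmetric_opD:
  "symmetric_op V T \<Longrightarrow> f \<in> ell2 V \<Longrightarrow> g \<in> ell2 V \<Longrightarrow>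
    ell2_inner V (T f) g = ell2_inner V f (T g)"
  by (simp add: symmetric_op_def)

lemma positive_op_bounded: "positive_op V T \<Longrightarrow> bounded_op V T"
  by (simp add: positive_op_def)

lemma positive_op_form:
  assumes "positive_op V T" "f \<in> ell2 V"
  shows "0 \<le> Re (ell2_inner V (T f) f)" "Im (ell2_inner V (T f) f) = 0"
  using assms by (auto simp: positive_op_def complex_nonneg_Reals_iff)

text \<open>Polarization: the form is real on \<open>f + g\<close> and on \<open>f + \<i> g\<close>.\<close>

lemma positive_op_symmetric:
  assumes "positive_op V T"
  shows "symmetric_op V T"
proof -
  have T: "bounded_op V T"
    using assms by (rule positive_op_bounded)
  have "ell2_inner V (T f) g = ell2_inner V f (T g)" if f: "f \<in> ell2 V" and g: "g \<in> ell2 V" for f g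
  proof -
    have [simp]: "T f \<in> ell2 V" "T g \<in> ell2 V"
      using T f g by (auto intro: bounded_op_in)
    have "Im (ell2_inner V (T f) g) + Im (ell2_inner V (T g) f) = 0"
      using positive_op_form(2)[OF assms ell2_add[OF f g]] positive_op_form(2)[OF assms f]
        positive_op_form(2)[OF assms g] f g
      by (simp add: bounded_op_add[OF T] ell2_inner_simps)
    moreover have "Re (ell2_inner V (T g) f) = Re (ell2_inner V (T f) g)"
      using positive_op_form(2)[OF assms ell2_add[OF f ell2_scale[OF g, of \<i>]]]
        positive_op_form(2)[OF assms f] positive_op_form(2)[OF assms g] f g
      by (simp add: bounded_op_add[OF T] bounded_op_scale[OF T] ell2_inner_simps)
    ultimately have "ell2_inner V (T f) g = cnj (ell2_inner V (T g) f)"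
      by (simp add: complex_eq_iff)
    then show ?thesis
      by (subst (2) ell2_inner_commute)
  qed
  with T show ?thesis
    by (simp add: symmetric_op_def)
qed

text \<open>The form is nonnegative at \<open>f + t * g\<close> for every \<open>t\<close>. It may
  vanish at a nonzero \<open>g\<close>, so the case \<open>b = 0\<close> is treated
  separately.\<close>

lemma positive_op_Cauchy_Schwarz:
  assumes "positive_op V T" and f: "f \<in> ell2 V" and g: "g \<in> ell2 V"
  shows "(cmod (ell2_inner V (T f) g))\<^sup>2 \<le>
    Re (ell2_inner V (T f) f) * Re (ell2_inner V (T g) g)"
proof -
  define a b z where "a = Re (ell2_inner V (T f) f)" and "b = Re (ell2_inner V (T g) g)"
    and "z = ell2_inner V (T f) g"
  have T: "bounded_op V T"
    using assms by (simp add: positive_op_bounded)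
  have [simp]: "T f \<in> ell2 V" "T g \<in> ell2 V"
    using T f g by (auto intro: bounded_op_in)
  have ab: "ell2_inner V (T f) f = of_real a" "ell2_inner V (T g) g = of_real b"
    using positive_op_form(2)[OF assms(1)] f g by (simp_all add: a_def b_def complex_eq_iff)
  have b0: "0 \<le> b"
    using positive_op_form(1)[OF assms(1) g] by (simp add: b_def)
  have gf: "ell2_inner V (T g) f = cnj z"
    unfolding z_def using symmetric_opD[OF positive_op_symmetric[OF assms(1)] g f]
    by (simp add: ell2_inner_commute[of V g])
  have quad: "0 \<le> a - 2 * s * (cmod z)\<^sup>2 + s\<^sup>2 * (cmod z)\<^sup>2 * b" for s :: real
  proof -
    \<comment> \<open>The factor \<open>z\<close> aligns the phase: both cross terms become the real
      number \<open>- s * (cmod z)\<^sup>2\<close>.\<close>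
    define t where "t = - of_real s * z"
    have "0 \<le> Re (ell2_inner V (T (\<lambda>x. f x + t * g x)) (\<lambda>x. f x + t * g x))"
      by (rule positive_op_form[OF assms(1)]) (use f g in simp)
    also have "ell2_inner V (T (\<lambda>x. f x + t * g x)) (\<lambda>x. f x + t * g x) =
        of_real a + cnj t * z + t * cnj z + t * cnj t * of_real b"
      using f g by (simp add: bounded_op_add[OF T] bounded_op_scale[OF T] ell2_inner_simps ab gf
          z_def[symmetric] algebra_simps)
    also have "Re \<dots> = a - 2 * s * (cmod z)\<^sup>2 + s\<^sup>2 * (cmod z)\<^sup>2 * b"
      unfolding t_def cmod_power2 by (simp add: power2_eq_square algebra_simps)
    finally show ?thesis .
  qed
  have "(cmod z)\<^sup>2 \<le> a * b"
  proof (cases "b = 0")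
    case True
    have "(cmod z)\<^sup>2 \<le> 0"
    proof (rule ccontr)
      assume "\<not> (cmod z)\<^sup>2 \<le> 0"
      \<comment> \<open>For \<open>b = 0\<close> the bound is affine in \<open>s\<close>, and this
        \<open>s\<close> gives it the value \<open>a - (a + 1) = -1\<close>.\<close>
      then show False
        using quad[of "(a + 1) / (2 * (cmod z)\<^sup>2)"] True by (simp add: field_simps)
    qed
    with True show ?thesis
      by simp
  next
    case False
    \<comment> \<open>The choice \<open>s = 1 / b\<close> minimises the quadratic, with minimum
      \<open>a - (cmod z)\<^sup>2 / b\<close>.\<close>
    with quad[of "1 / b"] b0 show ?thesis
      by (simp add: field_simps power2_eq_square)
  qed
  then show ?thesis
    by (simp add: a_def b_def z_def)
qed

section \<open>Cauchy-Schwarz and triangle inequality for the inner product\<close>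

text \<open>The form of the identity is the inner product itself, so the ordinary Cauchy-Schwarz
  inequality becomes an instance of the one for positive operators.\<close>

lemma identity_positive: "positive_op V (restrict (\<lambda>f. f) (ell2 V))"
  unfolding positive_op_def
  by (auto simp: ell2_inner_self intro!: bounded_opI[where K = 1])

lemma ell2_Cauchy_Schwarz:
  assumes "f \<in> ell2 V" "g \<in> ell2 V"
  shows "cmod (ell2_inner V f g) \<le> ell2_norm V f * ell2_norm V g"
proof -
  have "(cmod (ell2_inner V f g))\<^sup>2 \<le> (ell2_norm V f * ell2_norm V g)\<^sup>2"
    using positive_op_Cauchy_Schwarz[OF identity_positive assms] assms
    by (simp add: ell2_inner_self power_mult_distrib flip: of_real_power)
  then show ?thesis
    by (rule power2_le_imp_le) simp
qed

lemma ell2_norm_triangle: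
  assumes "f \<in> ell2 V" "g \<in> ell2 V"
  shows "ell2_norm V (\<lambda>x. f x + g x) \<le> ell2_norm V f + ell2_norm V g"
proof (rule power2_le_imp_le)
  have "(ell2_norm V (\<lambda>x. f x + g x))\<^sup>2 = Re (ell2_inner V (\<lambda>x. f x + g x) (\<lambda>x. f x + g x))"
    using assms by (simp only: ell2_inner_self ell2_add Re_complex_of_real)
  also have "\<dots> = (ell2_norm V f)\<^sup>2 + (ell2_norm V g)\<^sup>2 + 2 * Re (ell2_inner V f g)"
    using assms ell2_inner_commute[of V g f]
    by (simp add: ell2_inner_simps) (simp add: ell2_inner_self)
  also have "\<dots> \<le> (ell2_norm V f + ell2_norm V g)\<^sup>2"
    using ell2_Cauchy_Schwarz[OF assms] complex_Re_le_cmod[of "ell2_inner V f g"]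
    by (simp add: power2_sum)
  finally show "(ell2_norm V (\<lambda>x. f x + g x))\<^sup>2 \<le> (ell2_norm V f + ell2_norm V g)\<^sup>2" .
qed simp

lemma ell2_norm_sum:
  assumes "\<And>i. i \<in> I \<Longrightarrow> u i \<in> ell2 V"
  shows "ell2_norm V (\<lambda>x. \<Sum>i\<in>I. u i x) \<le> (\<Sum>i\<in>I. ell2_norm V (u i))"
  using assms
proof (induction I rule: infinite_finite_induct)
  case (insert i I)
  then have "ell2_norm V (\<lambda>x. u i x + (\<Sum>i\<in>I. u i x)) \<le>
      ell2_norm V (u i) + ell2_norm V (\<lambda>x. \<Sum>i\<in>I. u i x)"
    by (intro ell2_norm_triangle) auto
  with insert show ?case
    by fastforce
qed auto

section \<open>Pointwise limits and norm limits\<close>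

text \<open>Fatou's lemma for counting measure: every finite partial sum of the squared moduli of
  \<open>g\<close> is a limit of the corresponding sums for \<open>u n\<close>, all at most
  \<open>M\<^sup>2\<close>.\<close>

lemma ell2_pointwise_limit:
  assumes u: "\<And>n. u n \<in> ell2 V" "\<And>n. ell2_norm V (u n) \<le> M"
    and lim: "\<And>x. (\<lambda>n. u n x) \<longlonglongrightarrow> g x"
  shows "g \<in> ell2 V" "ell2_norm V g \<le> M"
proof -
  have outside: "g x = 0" if "x \<notin> V" for x
    using lim[of x] ell2_outside[OF u(1) that] by (simp add: LIMSEQ_const_iff)
  have M: "0 \<le> M"
    using order_trans[OF ell2_norm_nonneg u(2)] .
  have fin: "(\<Sum>x\<in>F. (cmod (g x))\<^sup>2) \<le> M\<^sup>2" if F: "finite F" "F \<subseteq> V" for F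
  proof (rule LIMSEQ_le_const2)
    show "(\<lambda>n. \<Sum>x\<in>F. (cmod (u n x))\<^sup>2) \<longlonglongrightarrow> (\<Sum>x\<in>F. (cmod (g x))\<^sup>2)"
      by (intro tendsto_intros lim)
    have "(\<Sum>x\<in>F. (cmod (u n x))\<^sup>2) \<le> (ell2_norm V (u n))\<^sup>2" for n
      unfolding ell2_norm_power2
      by (rule finite_sum_le_infsum) (use F ell2_summable[OF u(1)] in auto)
    moreover have "(ell2_norm V (u n))\<^sup>2 \<le> M\<^sup>2" for n
      using u(2) by (simp add: power_mono)
    ultimately show "\<exists>N. \<forall>n\<ge>N. (\<Sum>x\<in>F. (cmod (u n x))\<^sup>2) \<le> M\<^sup>2"
      by (meson order_trans)
  qed
  have summable: "(\<lambda>x. (cmod (g x))\<^sup>2) summable_on V"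
    by (rule nonneg_bdd_above_summable_on) (use fin in \<open>auto intro!: bdd_aboveI2[where M = "M\<^sup>2"]\<close>)
  then show "g \<in> ell2 V"
    using outside by (simp add: ell2_def)
  have "(ell2_norm V g)\<^sup>2 \<le> M\<^sup>2"
    unfolding ell2_norm_power2 by (rule infsum_le_finite_sums[OF summable fin])
  then show "ell2_norm V g \<le> M"
    using M by (rule power2_le_imp_le)
qed

lemma bounded_op_norm_limit:
  assumes "bounded_op V T" "\<And>n. u n \<in> ell2 V" "f \<in> ell2 V"
    and "(\<lambda>n. ell2_norm V (\<lambda>x. u n x - f x)) \<longlonglongrightarrow> 0"
  shows "(\<lambda>n. ell2_norm V (\<lambda>x. T (u n) x - T f x)) \<longlonglongrightarrow> 0"
proof -
  obtain K where K: "\<And>f. f \<in> ell2 V \<Longrightarrow> ell2_norm V (T f) \<le> K * ell2_norm V f"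
    using bounded_op_bound[OF assms(1)] by blast
  have bound: "ell2_norm V (\<lambda>x. T (u n) x - T f x) \<le> K * ell2_norm V (\<lambda>x. u n x - f x)" for n
    using K[OF ell2_diff[OF assms(2,3)]] by (simp add: bounded_op_diff[OF assms(1,2,3)])
  show ?thesis
    by (rule Lim_null_comparison[OF always_eventually tendsto_mult_right_zero[OF assms(4), of K]])
      (simp add: bound)
qed

lemma ell2_norm_limit_pointwise:
  assumes "\<And>n. u n \<in> ell2 V" "f \<in> ell2 V"
    and "(\<lambda>n. ell2_norm V (\<lambda>x. u n x - f x)) \<longlonglongrightarrow> 0"
  shows "(\<lambda>n. u n x) \<longlonglongrightarrow> f x"
proof (rule LIM_zero_cancel, rule Lim_null_comparison[OF always_eventually assms(3)])
  show "\<forall>n. norm (u n x - f x) \<le> ell2_norm V (\<lambda>x. u n x - f x)"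
    using cmod_le_ell2_norm[OF ell2_diff[OF assms(1,2)]] by simp
qed

lemma ell2_norm_limit_inner:
  assumes "\<And>n. u n \<in> ell2 V" "f \<in> ell2 V" "g \<in> ell2 V"
    and "(\<lambda>n. ell2_norm V (\<lambda>x. u n x - f x)) \<longlonglongrightarrow> 0"
  shows "(\<lambda>n. ell2_inner V (u n) g) \<longlonglongrightarrow> ell2_inner V f g"
proof (rule LIM_zero_cancel, rule Lim_null_comparison[OF always_eventually])
  show "\<forall>n. norm (ell2_inner V (u n) g - ell2_inner V f g) \<le>
      ell2_norm V (\<lambda>x. u n x - f x) * ell2_norm V g"
    using ell2_Cauchy_Schwarz[OF ell2_diff[OF assms(1,2)] assms(3)]
    by (simp add: ell2_inner_diff_left[OF assms(1,2,3)])
  show "(\<lambda>n. ell2_norm V (\<lambda>x. u n x - f x) * ell2_norm V g) \<longlonglongrightarrow> 0"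
    using tendsto_mult_left_zero[OF assms(4)] .
qed

section \<open>The binomial series of \<open>1 - sqrt (1 - x)\<close>\<close>

text \<open>The recursion compares coefficients in \<open>s = (x + s\<^sup>2) / 2\<close>, which
  \<open>s = 1 - sqrt (1 - x)\<close> satisfies. For positive \<open>k\<close> the value is the
  Catalan number of index \<open>k - 1\<close> divided by \<open>2 ^ (2 * k - 1)\<close>.\<close>

fun sqrt_coeff :: "nat \<Rightarrow> real" where
  "sqrt_coeff k =
    (if k = 0 then 0 else if k = 1 then 1/2
     else (\<Sum>i\<in>{1..<k}. sqrt_coeff i * sqrt_coeff (k - i)) / 2)"

declare sqrt_coeff.simps [simp del]

lemma sqrt_coeff_0 [simp]: "sqrt_coeff 0 = 0"
  by (simp add: sqrt_coeff.simps)

lemma sqrt_coeff_nonneg [simp]: "0 \<le> sqrt_coeff k"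
proof (induction k rule: less_induct)
  case (less k)
  then show ?case
    by (subst sqrt_coeff.simps) (auto intro!: sum_nonneg)
qed

text \<open>The identity \<open>2 s - s\<^sup>2 = x\<close> for \<open>s = 1 - sqrt (1 - x)\<close>, coefficient by coefficient.\<close>

lemma sqrt_coeff_convolution:
  "(\<Sum>i\<le>k. sqrt_coeff i * sqrt_coeff (k - i)) = 2 * sqrt_coeff k - (if k = 1 then 1 else 0)"
proof -
  have "(\<Sum>i\<le>k. sqrt_coeff i * sqrt_coeff (k - i)) =
      (\<Sum>i\<in>{1..<k}. sqrt_coeff i * sqrt_coeff (k - i))"
    by (rule sum.mono_neutral_right) (auto simp: not_less Suc_le_eq)
  also have "\<dots> = 2 * sqrt_coeff k - (if k = 1 then 1 else 0)"
    by (subst sqrt_coeff.simps[of k]) simp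
  finally show ?thesis .
qed

text \<open>The convolution identity gives \<open>2 * s' \<le> 1 + s * s\<close>, where
  \<open>s\<close> and \<open>s'\<close> are the partial sums up to \<open>N\<close> and
  \<open>Suc N\<close>. Hence the bound 1, the value of the function at \<open>x = 1\<close>,
  propagates.\<close>

lemma sqrt_coeff_partial_sums: "(\<Sum>k\<le>N. sqrt_coeff k) \<le> 1"
proof (induction N)
  case (Suc N)
  let ?D = "{(i, j). i + j \<le> Suc N}" and ?s = "\<Sum>k\<le>N. sqrt_coeff k"
  let ?p = "\<lambda>(i, j). sqrt_coeff i * sqrt_coeff j"
  have fin: "finite ?D"
    by (rule finite_subset[of _ "{..Suc N} \<times> {..Suc N}"]) auto
  have "2 * (\<Sum>k\<le>Suc N. sqrt_coeff k) =
      (\<Sum>k\<le>Suc N. (\<Sum>i\<le>k. sqrt_coeff i * sqrt_coeff (k - i)) + (if k = 1 then 1 else 0))"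
    by (simp add: sqrt_coeff_convolution sum_distrib_left del: sum.atMost_Suc)
  also have "\<dots> = (\<Sum>k\<le>Suc N. \<Sum>i\<le>k. sqrt_coeff i * sqrt_coeff (k - i)) + 1"
    unfolding sum.distrib by (simp add: sum.delta del: sum.atMost_Suc)
  also have "(\<Sum>k\<le>Suc N. \<Sum>i\<le>k. sqrt_coeff i * sqrt_coeff (k - i)) = sum ?p ?D"
    by (rule sum.triangle_reindex_eq[symmetric])
  \<comment> \<open>If one index exceeds \<open>N\<close>, it equals \<open>Suc N\<close> and the
    other is 0, where the coefficient vanishes. Only coefficients covered by the induction
    hypothesis remain.\<close>
  also have "sum ?p ?D = sum ?p (?D \<inter> {..N} \<times> {..N})"
  proof (rule sum.mono_neutral_right[OF fin])
    have "sqrt_coeff i * sqrt_coeff j = 0" if "i + j \<le> Suc N" "\<not> (i \<le> N \<and> j \<le> N)" for i j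
    proof -
      have "i = 0 \<or> j = 0"
        using that by linarith
      then show ?thesis
        by auto
    qed
    then show "\<forall>p\<in>?D - ?D \<inter> {..N} \<times> {..N}. ?p p = 0"
      by fastforce
  qed auto
  also have "\<dots> \<le> sum ?p ({..N} \<times> {..N})"
    by (rule sum_mono2) auto
  also have "\<dots> = ?s * ?s"
    by (simp add: sum_product sum.cartesian_product)
  also have "\<dots> \<le> 1"
    using Suc by (intro mult_le_one sum_nonneg) auto
  finally show ?case
    by simp
qed simp

lemma sqrt_coeff_summable: "summable sqrt_coeff"
proof (rule bounded_imp_summable)
  show "(\<Sum>k\<le>n. sqrt_coeff k) \<le> 1" for n
    by (rule sqrt_coeff_partial_sums)
qed simp

lemma sqrt_coeff_sum_le_1:
  assumes "finite I"
  shows "(\<Sum>k\<in>I. sqrt_coeff k) \<le> 1"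
proof -
  obtain N where "I \<subseteq> {..N}"
    using assms unfolding finite_nat_iff_bounded_le by blast
  then have "(\<Sum>k\<in>I. sqrt_coeff k) \<le> (\<Sum>k\<le>N. sqrt_coeff k)"
    by (intro sum_mono2) auto
  then show ?thesis
    using sqrt_coeff_partial_sums[of N] by linarith
qed

text \<open>Squaring the series: the double sum over \<open>(n, m)\<close> is regrouped along \<open>n + m = k\<close>.\<close>

lemma infsum_convolution:
  fixes c :: "nat \<Rightarrow> real" and u :: "nat \<Rightarrow> complex"
  assumes c: "summable c" "\<And>n. 0 \<le> c n" and u: "\<And>n. cmod (u n) \<le> M"
  shows "(\<Sum>\<^sub>\<infinity>n. of_real (c n) * (\<Sum>\<^sub>\<infinity>m. of_real (c m) * u (n + m))) =
    (\<Sum>\<^sub>\<infinity>k. of_real (\<Sum>i\<le>k. c i * c (k - i)) * u k)"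
proof -
  define f where "f = (\<lambda>(n, m). of_real (c n * c m) * u (n + m))"
  have c_sum: "c summable_on UNIV"
    by (rule summable_nonneg_imp_summable_on[OF c])
  have M: "0 \<le> M"
    using order_trans[OF norm_ge_zero u] .
  \<comment> \<open>This majorant makes the double family absolutely summable, which is what permits
    the regrouping.\<close>
  have "(\<lambda>(n, m). c n * c m * M) summable_on UNIV \<times> UNIV"
  proof (rule summable_on_SigmaI)
    show "((\<lambda>m. case (n, m) of (n, m) \<Rightarrow> c n * c m * M) has_sum c n * infsum c UNIV * M) UNIV" for n
      using c_sum by (auto intro!: has_sum_cmult_left has_sum_cmult_right)
    show "(\<lambda>n. c n * infsum c UNIV * M) summable_on UNIV"
      by (intro summable_on_cmult_left c_sum)
  qed (use c M in auto)
  then have "(\<lambda>p. norm (f p)) summable_on UNIV \<times> UNIV"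
    by (rule Infinite_Sum.abs_summable_on_comparison_test')
      (use c M u in \<open>auto simp: f_def norm_mult intro!: mult_left_mono\<close>)
  then have f: "f summable_on UNIV \<times> UNIV"
    by (rule abs_summable_summable)
  let ?g = "\<lambda>(k, i). of_real (c i * c (k - i)) * u k"
  let ?D = "SIGMA k:UNIV. {..k}"
  have g: "f summable_on UNIV \<times> UNIV \<longleftrightarrow> ?g summable_on ?D"
    by (rule summable_on_reindex_bij_witness[of _ "\<lambda>(k, i). (i, k - i)" "\<lambda>(n, m). (n + m, n)"])
      (auto simp: f_def)
  have "(\<Sum>\<^sub>\<infinity>n. of_real (c n) * (\<Sum>\<^sub>\<infinity>m. of_real (c m) * u (n + m))) = (\<Sum>\<^sub>\<infinity>n. \<Sum>\<^sub>\<infinity>m. f (n, m))"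
    by (simp add: f_def mult.assoc flip: infsum_cmult_right')
  also have "\<dots> = infsum f (UNIV \<times> UNIV)"
    using f by (rule infsum_Sigma_banach)
  also have "\<dots> = infsum ?g ?D"
    by (rule infsum_reindex_bij_witness[of _ "\<lambda>(k, i). (i, k - i)" "\<lambda>(n, m). (n + m, n)"])
      (auto simp: f_def)
  also have "\<dots> = (\<Sum>\<^sub>\<infinity>k. \<Sum>\<^sub>\<infinity>i\<in>{..k}. ?g (k, i))"
    using f g by (intro infsum_Sigma_banach[symmetric]) simp
  also have "\<dots> = (\<Sum>\<^sub>\<infinity>k. of_real (\<Sum>i\<le>k. c i * c (k - i)) * u k)"
    by (simp add: sum_distrib_right)
  finally show ?thesis .
qed

section \<open>Square roots of positive operators\<close>

text \<open>The operator \<open>B\<close> will be \<open>1 - T / K\<close> for a positive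
  \<open>T\<close> with norm bound \<open>K\<close>. Powers of a contraction stay contractions, so
  the coefficients alone control the series.\<close>

locale symmetric_contraction =
  fixes V :: "'a set" and B :: "('a \<Rightarrow> complex) \<Rightarrow> ('a \<Rightarrow> complex)"
  assumes symmetric: "symmetric_op V B"
    and contraction: "\<And>f. f \<in> ell2 V \<Longrightarrow> ell2_norm V (B f) \<le> ell2_norm V f"
begin

definition partial :: "nat \<Rightarrow> ('a \<Rightarrow> complex) \<Rightarrow> ('a \<Rightarrow> complex)" where
  "partial N f = (\<lambda>x. \<Sum>n<N. of_real (sqrt_coeff n) * (B ^^ n) f x)"

text \<open>The operator \<open>1 - sqrt (1 - B)\<close>.\<close>

definition series :: "('a \<Rightarrow> complex) \<Rightarrow> ('a \<Rightarrow> complex)" where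
  "series f = (\<lambda>x. \<Sum>\<^sub>\<infinity>n. of_real (sqrt_coeff n) * (B ^^ n) f x)"

lemma bounded: "bounded_op V B"
  using symmetric by (simp add: symmetric_op_def)

lemma pow_in: "f \<in> ell2 V \<Longrightarrow> (B ^^ n) f \<in> ell2 V"
  by (induction n) (auto intro: bounded_op_in[OF bounded])

lemma pow_norm: "f \<in> ell2 V \<Longrightarrow> ell2_norm V ((B ^^ n) f) \<le> ell2_norm V f"
  by (induction n) (auto intro: order_trans[OF contraction] pow_in)

lemma pow_add:
  "f \<in> ell2 V \<Longrightarrow> g \<in> ell2 V \<Longrightarrow> (B ^^ n) (\<lambda>x. f x + g x) = (\<lambda>x. (B ^^ n) f x + (B ^^ n) g x)"
  by (induction n) (auto simp: bounded_op_add[OF bounded pow_in pow_in])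

lemma pow_scale: "f \<in> ell2 V \<Longrightarrow> (B ^^ n) (\<lambda>x. c * f x) = (\<lambda>x. c * (B ^^ n) f x)"
  by (induction n) (auto simp: bounded_op_scale[OF bounded pow_in])

lemma pow_symmetric:
  "f \<in> ell2 V \<Longrightarrow> g \<in> ell2 V \<Longrightarrow> ell2_inner V ((B ^^ n) f) g = ell2_inner V f ((B ^^ n) g)"
proof (induction n arbitrary: g)
  case (Suc n)
  then have "ell2_inner V ((B ^^ Suc n) f) g = ell2_inner V ((B ^^ n) f) (B g)"
    by (simp add: symmetric_opD[OF symmetric pow_in])
  then show ?case
    using Suc by (simp add: bounded_op_in[OF bounded] funpow_swap1)
qed simp

lemma term_in: "f \<in> ell2 V \<Longrightarrow> (\<lambda>x. of_real (sqrt_coeff n) * (B ^^ n) f x) \<in> ell2 V"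
  by (simp add: pow_in)

text \<open>Kept general in \<open>I\<close> to serve both the partial sums over
  \<open>{..<N}\<close> and the blocks \<open>{N..<M + N}\<close> of the tail.\<close>

lemma segment_norm:
  assumes "f \<in> ell2 V"
  shows "ell2_norm V (\<lambda>x. \<Sum>n\<in>I. of_real (sqrt_coeff n) * (B ^^ n) f x) \<le>
    (\<Sum>n\<in>I. sqrt_coeff n) * ell2_norm V f"
proof -
  have "ell2_norm V (\<lambda>x. \<Sum>n\<in>I. of_real (sqrt_coeff n) * (B ^^ n) f x) \<le>
      (\<Sum>n\<in>I. ell2_norm V (\<lambda>x. of_real (sqrt_coeff n) * (B ^^ n) f x))"
    by (rule ell2_norm_sum) (rule term_in[OF assms])
  also have "\<dots> \<le> (\<Sum>n\<in>I. sqrt_coeff n * ell2_norm V f)"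
    by (rule sum_mono)
      (simp add: ell2_norm_scale[OF pow_in[OF assms]] mult_left_mono pow_norm[OF assms])
  finally show ?thesis
    by (simp add: sum_distrib_right)
qed

lemma partial_in: "f \<in> ell2 V \<Longrightarrow> partial N f \<in> ell2 V"
  unfolding partial_def by (intro ell2_sum term_in)

text \<open>At each point the terms are dominated by \<open>sqrt_coeff n * ell2_norm V f\<close>, so
  the series converges absolutely there.\<close>

lemma partial_pointwise:
  assumes "f \<in> ell2 V"
  shows "(\<lambda>N. partial N f x) \<longlonglongrightarrow> series f x"
proof -
  have "summable (\<lambda>n. norm (of_real (sqrt_coeff n) * (B ^^ n) f x))"
  proof (rule summable_comparison_test')
    show "summable (\<lambda>n. sqrt_coeff n * ell2_norm V f)"
      by (rule summable_mult2[OF sqrt_coeff_summable])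
    show "norm (norm (of_real (sqrt_coeff n) * (B ^^ n) f x)) \<le> sqrt_coeff n * ell2_norm V f"
      if "0 \<le> n" for n
      using order_trans[OF cmod_le_ell2_norm[OF pow_in[OF assms]] pow_norm[OF assms]]
      by (simp add: norm_mult mult_left_mono)
  qed
  then have "(\<lambda>n. of_real (sqrt_coeff n) * (B ^^ n) f x) sums series f x"
    unfolding series_def by (intro has_sum_imp_sums has_sum_infsum norm_summable_imp_summable_on)
  then show ?thesis
    by (simp add: sums_def partial_def)
qed

text \<open>The coefficients sum to at most 1, so the partial sums are bounded by the norm of
  \<open>f\<close>. The bound passes to their pointwise limit.\<close>

lemma
  assumes "f \<in> ell2 V"
  shows series_in: "series f \<in> ell2 V"
    and series_norm: "ell2_norm V (series f) \<le> ell2_norm V f"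
proof -
  have "ell2_norm V (partial N f) \<le> ell2_norm V f" for N
    using segment_norm[OF assms, of "{..<N}"] sqrt_coeff_sum_le_1[of "{..<N}"]
      mult_right_mono[of "\<Sum>n<N. sqrt_coeff n" 1 "ell2_norm V f"]
    by (simp add: partial_def)
  note * = ell2_pointwise_limit[where u = "\<lambda>N. partial N f",
      OF partial_in[OF assms] this partial_pointwise[OF assms]]
  show "series f \<in> ell2 V" "ell2_norm V (series f) \<le> ell2_norm V f"
    by (rule *)+
qed

text \<open>Upgrades pointwise to norm convergence. For fixed \<open>N\<close> the blocks from
  \<open>N\<close> to \<open>M + N\<close> are bounded by the coefficient tail \<open>?t N\<close>;
  letting \<open>M\<close> grow transfers this bound to the whole remainder, and the tail tends to
  0.\<close>

lemma partial_limit: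
  assumes "f \<in> ell2 V"
  shows "(\<lambda>N. ell2_norm V (\<lambda>x. partial N f x - series f x)) \<longlonglongrightarrow> 0"
proof -
  let ?t = "\<lambda>N. (suminf sqrt_coeff - (\<Sum>n<N. sqrt_coeff n)) * ell2_norm V f"
  have "ell2_norm V (\<lambda>x. series f x - partial N f x) \<le> ?t N" for N
  proof (rule ell2_pointwise_limit(2))
    let ?u = "\<lambda>M x. partial (M + N) f x - partial N f x"
    show "?u M \<in> ell2 V" for M
      by (intro ell2_diff partial_in assms)
    show "(\<lambda>M. ?u M x) \<longlonglongrightarrow> series f x - partial N f x" for x
      by (intro tendsto_diff tendsto_const LIMSEQ_ignore_initial_segment partial_pointwise assms)
    fix M
    have "?u M = (\<lambda>x. \<Sum>n\<in>{N..<M + N}. of_real (sqrt_coeff n) * (B ^^ n) f x)"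
      unfolding partial_def by (rule ext) (simp add: sum_diff_nat_ivl flip: atLeast0LessThan)
    then have "ell2_norm V (?u M) \<le> (\<Sum>n\<in>{N..<M + N}. sqrt_coeff n) * ell2_norm V f"
      by (simp add: segment_norm[OF assms])
    also have "(\<Sum>n\<in>{N..<M + N}. sqrt_coeff n) = (\<Sum>n<M + N. sqrt_coeff n) - (\<Sum>n<N. sqrt_coeff n)"
      by (simp add: sum_diff_nat_ivl flip: atLeast0LessThan)
    also have "\<dots> * ell2_norm V f \<le> ?t N"
      by (intro mult_right_mono diff_right_mono sum_le_suminf sqrt_coeff_summable) auto
    finally show "ell2_norm V (?u M) \<le> ?t N" .
  qed
  then have bound: "ell2_norm V (\<lambda>x. partial N f x - series f x) \<le> ?t N" for N
    by (subst ell2_norm_minus_commute)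
  have "?t \<longlonglongrightarrow> (suminf sqrt_coeff - suminf sqrt_coeff) * ell2_norm V f"
    by (intro tendsto_intros summable_LIMSEQ sqrt_coeff_summable)
  then have "?t \<longlonglongrightarrow> 0"
    by simp
  then show ?thesis
    by (rule Lim_null_comparison[OF always_eventually, rotated]) (simp add: bound)
qed

text \<open>\<open>P\<close> commutes with each partial sum. Norm convergence is used to pass to the
  limit, since a bounded operator is continuous for the norm. The instances of interest are
  \<open>P = B\<close> and a competing square root.\<close>

lemma series_commute:
  assumes P: "bounded_op V P" and comm: "\<And>f. f \<in> ell2 V \<Longrightarrow> P (B f) = B (P f)" and f: "f \<in> ell2 V"
  shows "P (series f) = series (P f)"
proof
  fix x
  have pow: "P ((B ^^ n) f) = (B ^^ n) (P f)" for n
    by (induction n) (simp_all add: comm pow_in f)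
  have "P (partial N f) = partial N (P f)" for N
    unfolding partial_def
    by (simp add: bounded_op_sum[OF P term_in[OF f]] bounded_op_scale[OF P pow_in[OF f]] pow)
  then have "(\<lambda>N. partial N (P f) x) \<longlonglongrightarrow> P (series f) x"
    using ell2_norm_limit_pointwise[OF bounded_op_in[OF P partial_in[OF f]]
        bounded_op_in[OF P series_in[OF f]]
        bounded_op_norm_limit[OF P partial_in[OF f] series_in[OF f] partial_limit[OF f]]]
    by simp
  then show "P (series f) x = series (P f) x"
    using partial_pointwise[OF bounded_op_in[OF P f]] LIMSEQ_unique by blast
qed

lemma series_add:
  assumes "f \<in> ell2 V" "g \<in> ell2 V"
  shows "series (\<lambda>x. f x + g x) = (\<lambda>x. series f x + series g x)"
proof
  fix x
  have "(\<lambda>N. partial N (\<lambda>x. f x + g x) x) = (\<lambda>N. partial N f x + partial N g x)"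
    by (simp add: partial_def pow_add[OF assms] distrib_left sum.distrib)
  then have "(\<lambda>N. partial N (\<lambda>x. f x + g x) x) \<longlonglongrightarrow> series f x + series g x"
    using tendsto_add[OF partial_pointwise partial_pointwise] assms by simp
  then show "series (\<lambda>x. f x + g x) x = series f x + series g x"
    using partial_pointwise[OF ell2_add[OF assms]] LIMSEQ_unique by blast
qed

lemma series_scale:
  assumes "f \<in> ell2 V"
  shows "series (\<lambda>x. c * f x) = (\<lambda>x. c * series f x)"
  unfolding series_def
  by (simp add: pow_scale[OF assms] mult.left_commute[of _ c] infsum_cmult_right')

lemma series_symmetric:
  assumes f: "f \<in> ell2 V" and g: "g \<in> ell2 V"
  shows "ell2_inner V (series f) g = ell2_inner V f (series g)"
proof -
  have partial_Suc: "partial (Suc N) h = (\<lambda>x. partial N h x + of_real (sqrt_coeff N) * (B ^^ N) h x)"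
    for N h by (simp add: partial_def)
  have "ell2_inner V (partial N f) g = ell2_inner V f (partial N g)" for N
  proof (induction N)
    case (Suc N)
    then show ?case
      unfolding partial_Suc using f g
      by (simp add: ell2_inner_simps partial_in pow_in pow_symmetric)
  qed (simp add: partial_def ell2_inner_def)
  moreover have "(\<lambda>N. ell2_inner V (partial N f) g) \<longlonglongrightarrow> ell2_inner V (series f) g"
    by (intro ell2_norm_limit_inner partial_in series_in partial_limit f g)
  \<comment> \<open>Continuity is available in the first argument; conjugation carries it over to
    the second.\<close>
  moreover have "(\<lambda>N. cnj (ell2_inner V (partial N g) f)) \<longlonglongrightarrow> cnj (ell2_inner V (series g) f)"
    by (intro tendsto_cnj ell2_norm_limit_inner partial_in series_in partial_limit f g)
  ultimately show ?thesis
    using LIMSEQ_unique by (auto simp: ell2_inner_commute[of V f])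
qed

text \<open>The operator form of \<open>s\<^sup>2 = 2 * s - x\<close>: the iterated series is a
  Cauchy product, whose coefficients are the convolutions of \<open>sqrt_coeff\<close>.\<close>

lemma series_series:
  assumes f: "f \<in> ell2 V"
  shows "series (series f) = (\<lambda>x. 2 * series f x - B f x)"
proof
  fix x
  let ?c = "\<lambda>n. of_real (sqrt_coeff n) :: complex" and ?u = "\<lambda>k. (B ^^ k) f x"
  have u: "cmod (?u k) \<le> ell2_norm V f" for k
    by (rule order_trans[OF cmod_le_ell2_norm[OF pow_in[OF f]] pow_norm[OF f]])
  have "(B ^^ n) (series f) = series ((B ^^ n) f)" for n
    by (induction n) (simp_all add: series_commute[OF bounded] pow_in[OF f])
  then have "series (series f) x = (\<Sum>\<^sub>\<infinity>n. ?c n * (\<Sum>\<^sub>\<infinity>m. ?c m * ?u (n + m)))"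
    unfolding series_def[of "series f"]
    by (simp add: series_def add.commute flip: funpow_add[unfolded o_def, THEN fun_cong])
  also have "\<dots> = (\<Sum>\<^sub>\<infinity>k. of_real (\<Sum>i\<le>k. sqrt_coeff i * sqrt_coeff (k - i)) * ?u k)"
    by (rule infsum_convolution[OF sqrt_coeff_summable sqrt_coeff_nonneg u])
  \<comment> \<open>The convolution is twice the coefficient except at \<open>k = 1\<close>, where
    the correction contributes \<open>- B f x\<close>.\<close>
  also have "\<dots> = (\<Sum>\<^sub>\<infinity>k. 2 * (?c k * ?u k) + (if k = 1 then - ?u 1 else 0))"
    by (intro infsum_cong) (simp add: sqrt_coeff_convolution algebra_simps)
  also have "\<dots> = (\<Sum>\<^sub>\<infinity>k. 2 * (?c k * ?u k)) + (\<Sum>\<^sub>\<infinity>k. if k = (1::nat) then - ?u 1 else 0)"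
  proof (rule infsum_add)
    have "summable (\<lambda>k. norm (?c k * ?u k))"
      by (rule summable_comparison_test'[OF summable_mult2[OF sqrt_coeff_summable, of "ell2_norm V f"]])
        (use u in \<open>simp add: norm_mult mult_left_mono\<close>)
    then show "(\<lambda>k. 2 * (?c k * ?u k)) summable_on UNIV"
      by (intro summable_on_cmult_right norm_summable_imp_summable_on)
    show "(\<lambda>k. if k = (1::nat) then - ?u 1 else 0) summable_on UNIV"
      by (rule finite_nonzero_values_imp_summable_on) simp
  qed
  also have "(\<Sum>\<^sub>\<infinity>k. if k = (1::nat) then - ?u 1 else 0) = (\<Sum>\<^sub>\<infinity>k\<in>{1::nat}. - ?u 1)"
    by (rule infsum_cong_neutral) auto
  finally show "series (series f) x = 2 * series f x - B f x"
    by (simp add: infsum_cmult_right' series_def)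
qed

section \<open>The square root of 1 - B\<close>

definition root :: "('a \<Rightarrow> complex) \<Rightarrow> ('a \<Rightarrow> complex)" where
  "root = restrict (\<lambda>f x. f x - series f x) (ell2 V)"

lemma root_apply: "f \<in> ell2 V \<Longrightarrow> root f = (\<lambda>x. f x - series f x)"
  by (simp add: root_def)

text \<open>Symmetry of \<open>series\<close> makes the form real, and \<open>series\<close> is a
  contraction, so by Cauchy-Schwarz its form at \<open>f\<close> does not exceed the squared norm of
  \<open>f\<close>.\<close>

lemma root_positive: "positive_op V root"
  unfolding positive_op_def
proof (intro conjI ballI)
  show "bounded_op V root"
    unfolding root_def
  proof (rule bounded_opI)
    show "ell2_norm V (\<lambda>x. f x - series f x) \<le> 2 * ell2_norm V f" if f: "f \<in> ell2 V" for f
      using ell2_norm_triangle[OF f ell2_scale[OF series_in[OF f], of "-1"]]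
        ell2_norm_scale[OF series_in[OF f], of "-1"] series_norm[OF f]
      by simp
  qed (simp_all add: series_in series_add series_scale algebra_simps)
  fix f
  assume f: "f \<in> ell2 V"
  have real: "Im (ell2_inner V (series f) f) = 0"
    using series_symmetric[OF f f] ell2_inner_commute[of V f "series f"] by (simp add: complex_eq_iff)
  have "Re (ell2_inner V (series f) f) \<le> ell2_norm V (series f) * ell2_norm V f"
    by (rule order_trans[OF complex_Re_le_cmod ell2_Cauchy_Schwarz[OF series_in[OF f] f]])
  also have "\<dots> \<le> (ell2_norm V f)\<^sup>2"
    unfolding power2_eq_square by (intro mult_right_mono series_norm f) simp
  finally show "ell2_inner V (root f) f \<in> \<real>\<^sub>\<ge>\<^sub>0"
    using real f
    by (simp add: root_apply complex_nonneg_Reals_iff ell2_inner_diff_left series_in ell2_inner_self)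
qed

text \<open>With \<open>s\<close> for \<open>series\<close>,
  \<open>(1 - s)\<^sup>2 = 1 - 2 * s + s\<^sup>2\<close>, and the last two terms add up to
  \<open>- B\<close> by \<open>series_series\<close>.\<close>

lemma root_root:
  assumes f: "f \<in> ell2 V"
  shows "root (root f) = (\<lambda>x. f x - B f x)"
proof -
  have "series (\<lambda>x. f x - series f x) = (\<lambda>x. series f x - series (series f) x)"
    using series_add[OF f ell2_scale[OF series_in[OF f], of "-1"]]
      series_scale[OF series_in[OF f], of "-1"] by simp
  then show ?thesis
    using f by (simp add: root_apply series_in series_series)
qed

lemma root_commute:
  assumes "bounded_op V P" "\<And>f. f \<in> ell2 V \<Longrightarrow> P (B f) = B (P f)" "f \<in> ell2 V"
  shows "P (root f) = root (P f)"
  using series_commute[OF assms] assms(3)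
  by (simp add: root_apply bounded_op_in[OF assms(1)] bounded_op_diff[OF assms(1)] series_in)

end

section \<open>Existence and uniqueness of positive square roots\<close>

text \<open>The operator inequality \<open>T\<^sup>2 \<le> K * T\<close>. Cauchy-Schwarz for the
  form of \<open>T\<close> at \<open>f\<close> and \<open>T f\<close> bounds the fourth power of the
  norm of \<open>T f\<close>; one factor of its square is then cancelled, hence the case
  distinction.\<close>

lemma positive_op_norm:
  assumes T: "positive_op V T"
    and K: "0 \<le> K" "\<And>f. f \<in> ell2 V \<Longrightarrow> ell2_norm V (T f) \<le> K * ell2_norm V f"
    and f: "f \<in> ell2 V"
  shows "(ell2_norm V (T f))\<^sup>2 \<le> K * Re (ell2_inner V (T f) f)"
proof (cases "ell2_norm V (T f) = 0")
  case True
  then show ?thesis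
    using K(1) positive_op_form(1)[OF T f] by simp
next
  case False
  define n where "n = ell2_norm V (T f)"
  have Tf: "T f \<in> ell2 V" and TTf: "T (T f) \<in> ell2 V"
    using f bounded_op_in[OF positive_op_bounded[OF T]] by auto
  have "Re (ell2_inner V (T (T f)) (T f)) \<le> ell2_norm V (T (T f)) * n"
    unfolding n_def by (rule order_trans[OF complex_Re_le_cmod ell2_Cauchy_Schwarz[OF TTf Tf]])
  also have "\<dots> \<le> K * n * n"
    unfolding n_def by (intro mult_right_mono K(2) Tf) simp
  finally have "Re (ell2_inner V (T f) f) * Re (ell2_inner V (T (T f)) (T f)) \<le>
      Re (ell2_inner V (T f) f) * (K * n\<^sup>2)"
    using positive_op_form(1)[OF T f] by (intro mult_left_mono) (auto simp: power2_eq_square)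
  moreover have "(n\<^sup>2)\<^sup>2 \<le> Re (ell2_inner V (T f) f) * Re (ell2_inner V (T (T f)) (T f))"
    using positive_op_Cauchy_Schwarz[OF T f Tf]
    by (simp add: ell2_inner_self[OF Tf] n_def norm_power)
  ultimately have "n\<^sup>2 * n\<^sup>2 \<le> (K * Re (ell2_inner V (T f) f)) * n\<^sup>2"
    by (simp add: power2_eq_square mult_ac)
  then show ?thesis
    using False mult_right_le_imp_le[of "n\<^sup>2" "n\<^sup>2"] by (simp add: n_def)
qed

lemma positive_op_eq_0:
  assumes "positive_op V T" "f \<in> ell2 V" "Re (ell2_inner V (T f) f) = 0"
  shows "T f = (\<lambda>x. 0)"
proof -
  obtain K where K: "0 < K" "\<And>f. f \<in> ell2 V \<Longrightarrow> ell2_norm V (T f) \<le> K * ell2_norm V f"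
    using bounded_op_bound[OF positive_op_bounded[OF assms(1)]] by blast
  have "(ell2_norm V (T f))\<^sup>2 \<le> 0"
    using positive_op_norm[OF assms(1) less_imp_le[OF K(1)] K(2) assms(2)] assms(3) by simp
  then show ?thesis
    using ell2_norm_eq_0D[OF bounded_op_in[OF positive_op_bounded[OF assms(1)] assms(2)]] by simp
qed

text \<open>With \<open>B = 1 - T / K\<close> the operator \<open>root\<close> squares to
  \<open>T / K\<close>, so \<open>S\<close> is \<open>root\<close> scaled by \<open>sqrt K\<close>.
  Commutation with everything that commutes with \<open>T\<close> is recorded because uniqueness
  depends on it.\<close>

lemma positive_op_sqrt_exists:
  assumes T: "positive_op V T"
  obtains S where "positive_op V S" "compose (ell2 V) S S = T"
    "\<And>P f. bounded_op V P \<Longrightarrow> (\<And>f. f \<in> ell2 V \<Longrightarrow> P (T f) = T (P f)) \<Longrightarrow> f \<in> ell2 V \<Longrightarrow>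
      P (S f) = S (P f)"
proof -
  have bT: "bounded_op V T"
    using T by (rule positive_op_bounded)
  obtain K where K: "0 < K" "\<And>f. f \<in> ell2 V \<Longrightarrow> ell2_norm V (T f) \<le> K * ell2_norm V f"
    using bounded_op_bound[OF bT] by blast
  define r where "r = 1 / K"
  define B where "B = restrict (\<lambda>f x. f x - of_real r * T f x) (ell2 V)"
  have B: "B f = (\<lambda>x. f x - of_real r * T f x)" if "f \<in> ell2 V" for f
    using that by (simp add: B_def)
  note [simp] = bounded_op_in[OF bT]
  have contraction: "ell2_norm V (B f) \<le> ell2_norm V f" if f: "f \<in> ell2 V" for f
  proof (rule power2_le_imp_le)
    have Bf: "B f \<in> ell2 V"
      using f by (simp add: B)
    have "(ell2_norm V (B f))\<^sup>2 = Re (ell2_inner V (B f) (B f))"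
      by (simp add: ell2_inner_self[OF Bf])
    also have "\<dots> = (ell2_norm V f)\<^sup>2 - 2 / K * Re (ell2_inner V (T f) f)
        + (ell2_norm V (T f))\<^sup>2 / K\<^sup>2"
      using f K(1) symmetric_opD[OF positive_op_symmetric[OF T] f f, symmetric]
        ell2_inner_self[of f] ell2_inner_self[of "T f"]
      by (simp add: B ell2_inner_simps) (simp add: r_def power2_eq_square field_simps)
    \<comment> \<open>By \<open>positive_op_norm\<close> the quadratic term uses up only half of the
      negative term, leaving \<open>- Re (ell2_inner V (T f) f) / K\<close>.\<close>
    also have "\<dots> \<le> (ell2_norm V f)\<^sup>2 - 2 / K * Re (ell2_inner V (T f) f)
        + K * Re (ell2_inner V (T f) f) / K\<^sup>2"
      by (intro add_left_mono divide_right_mono zero_le_power2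
          positive_op_norm[OF T less_imp_le[OF K(1)] K(2) f])
    also have "\<dots> \<le> (ell2_norm V f)\<^sup>2"
      using K(1) positive_op_form(1)[OF T f] by (simp add: field_simps power2_eq_square)
    finally show "(ell2_norm V (B f))\<^sup>2 \<le> (ell2_norm V f)\<^sup>2" .
  qed simp
  have bB: "bounded_op V B"
    unfolding B_def
  proof (rule bounded_opI[where K = 1])
    show "ell2_norm V (\<lambda>x. f x - of_real r * T f x) \<le> 1 * ell2_norm V f" if "f \<in> ell2 V" for f
      using contraction[OF that] that by (simp add: B)
  qed (auto simp: bounded_op_add[OF bT] bounded_op_scale[OF bT] algebra_simps)
  interpret symmetric_contraction V B
  proof
    show "symmetric_op V B"
      unfolding symmetric_op_def
      using bB by (auto simp: B ell2_inner_simps symmetric_opD[OF positive_op_symmetric[OF T]])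
  qed (rule contraction)
  define S where "S = restrict (\<lambda>f x. of_real (sqrt K) * root f x) (ell2 V)"
  have S: "S f = (\<lambda>x. of_real (sqrt K) * root f x)" if "f \<in> ell2 V" for f
    using that by (simp add: S_def)
  have broot: "bounded_op V root"
    using root_positive by (rule positive_op_bounded)
  note [simp] = bounded_op_in[OF broot]
  obtain L where L: "\<And>f. f \<in> ell2 V \<Longrightarrow> ell2_norm V (root f) \<le> L * ell2_norm V f"
    using bounded_op_bound[OF broot] by blast
  have bS: "bounded_op V S"
    unfolding S_def
  proof (rule bounded_opI[where K = "sqrt K * L"])
    show "ell2_norm V (\<lambda>x. of_real (sqrt K) * root f x) \<le> sqrt K * L * ell2_norm V f"
      if "f \<in> ell2 V" for f
      using mult_left_mono[OF L[OF that], of "sqrt K"] K(1) that by (simp add: ell2_norm_scale mult.assoc)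
  qed (auto simp: bounded_op_add[OF broot] bounded_op_scale[OF broot] algebra_simps)
  have "positive_op V S"
    unfolding positive_op_def
    using bS positive_op_form[OF root_positive] K(1)
    by (auto simp: S ell2_inner_scale_left complex_nonneg_Reals_iff)
  moreover have "compose (ell2 V) S S = T"
  proof (rule bounded_op_eqI[OF bounded_op_compose[OF bS bS] bT])
    fix f
    assume f: "f \<in> ell2 V"
    have "compose (ell2 V) S S f = (\<lambda>x. of_real K * root (root f) x)"
      using f K(1)
      by (simp add: compose_def S bounded_op_scale[OF broot] mult.assoc[symmetric] flip: of_real_mult)
    also have "\<dots> = T f"
      using f K(1) by (simp add: root_root B r_def)
    finally show "compose (ell2 V) S S f = T f" .
  qed
  moreover have "P (S f) = S (P f)"
    if P: "bounded_op V P" and comm: "\<And>f. f \<in> ell2 V \<Longrightarrow> P (T f) = T (P f)" and f: "f \<in> ell2 V" for P f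
  proof -
    note [simp] = bounded_op_in[OF P]
    have "P (B g) = B (P g)" if "g \<in> ell2 V" for g
      using that by (simp add: B bounded_op_diff[OF P] bounded_op_scale[OF P] comm)
    then have "P (root f) = root (P f)"
      by (rule root_commute[OF P _ f])
    then show ?thesis
      using f by (simp add: S bounded_op_scale[OF P])
  qed
  ultimately show thesis
    by (rule that)
qed

text \<open>
  For another root \<open>P\<close>, the square root \<open>S\<close> commutes with \<open>P\<close>, so \<open>(S + P) (S - P) = 0\<close>.
  Hence \<open>S\<close> and \<open>P\<close> both vanish at \<open>(S - P) f\<close>, and so does \<open>(S - P)\<^sup>2\<close> at \<open>f\<close>.
\<close>

theorem positive_op_sqrt_unique:
  assumes T: "positive_op V T"
  shows "\<exists>!S. positive_op V S \<and> compose (ell2 V) S S = T"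
proof -
  obtain S where S: "positive_op V S" "compose (ell2 V) S S = T"
    and commute: "\<And>P f. bounded_op V P \<Longrightarrow> (\<And>f. f \<in> ell2 V \<Longrightarrow> P (T f) = T (P f)) \<Longrightarrow>
      f \<in> ell2 V \<Longrightarrow> P (S f) = S (P f)"
    using positive_op_sqrt_exists[OF T] by metis
  have bS: "bounded_op V S"
    using S(1) by (rule positive_op_bounded)
  have "P = S" if P: "positive_op V P" "compose (ell2 V) P P = T" for P
  proof -
    have bP: "bounded_op V P"
      using P(1) by (rule positive_op_bounded)
    have TP: "T f = P (P f)" and TS: "T f = S (S f)" if "f \<in> ell2 V" for f
      using fun_cong[OF P(2), of f] fun_cong[OF S(2), of f] that by (simp_all add: compose_def)
    note [simp] = bounded_op_in[OF bP] bounded_op_in[OF bS]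
    have comm: "P (S f) = S (P f)" if "f \<in> ell2 V" for f
      by (rule commute[OF bP _ that]) (simp add: TP)
    show "P = S"
    proof (rule bounded_op_eqI[OF bP bS, symmetric, symmetric])
      fix f
      assume f: "f \<in> ell2 V"
      define g where "g = (\<lambda>x. S f x - P f x)"
      have g: "g \<in> ell2 V"
        using f by (simp add: g_def)
      have "S g x = - P g x" for x
        using fun_cong[OF TP[OF f], of x] fun_cong[OF TS[OF f], of x] f
        by (simp add: g_def bounded_op_diff[OF bS] bounded_op_diff[OF bP] comm)
      then have "S g = (\<lambda>x. (-1) * P g x)"
        by auto
      then have "ell2_inner V (S g) g = - ell2_inner V (P g) g"
        using g by (simp only: ell2_inner_scale_left bounded_op_in[OF bP]) simp
      then have "Re (ell2_inner V (S g) g) = 0" "Re (ell2_inner V (P g) g) = 0"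
        using positive_op_form(1)[OF S(1) g] positive_op_form(1)[OF P(1) g] by auto
      then have "S g = (\<lambda>x. 0)" "P g = (\<lambda>x. 0)"
        using positive_op_eq_0 S(1) P(1) g by auto
      moreover have "ell2_inner V g g = ell2_inner V f (S g) - ell2_inner V f (P g)"
        using f g symmetric_opD[OF positive_op_symmetric[OF S(1)] f g]
          symmetric_opD[OF positive_op_symmetric[OF P(1)] f g]
        by (subst (1) g_def) (simp add: ell2_inner_diff_left)
      ultimately have "ell2_norm V g = 0"
        using ell2_inner_self[OF g] by simp
      then show "P f = S f"
        using ell2_eqI[of "S f" V "P f"] f by (simp add: g_def)
    qed
  qed
  with S show ?thesis
    by blast
qed

section \<open>Adjoint and absolute value of a symmetric operator\<close>

lemma sqrt_op:
  assumes "positive_op V T"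
  shows "positive_op V (sqrt_op V T)" "compose (ell2 V) (sqrt_op V T) (sqrt_op V T) = T"
  using theI'[OF positive_op_sqrt_unique[OF assms]] by (simp_all add: sqrt_op_def)

text \<open>\<open>T\<close> itself meets the description. For another candidate \<open>S\<close>,
  the difference \<open>S g - T g\<close> is orthogonal to all of \<open>ell2 V\<close>, in
  particular to itself.\<close>

lemma adjoint_op_symmetric:
  assumes "symmetric_op V T"
  shows "adjoint_op V T = T"
  unfolding adjoint_op_def
proof (rule the_equality)
  show "bounded_op V T \<and> (\<forall>f\<in>ell2 V. \<forall>g\<in>ell2 V. ell2_inner V (T f) g = ell2_inner V f (T g))"
    using assms by (simp add: symmetric_op_def)
next
  fix S
  assume S: "bounded_op V S \<and> (\<forall>f\<in>ell2 V. \<forall>g\<in>ell2 V. ell2_inner V (T f) g = ell2_inner V f (S g))"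
  have T: "bounded_op V T"
    using assms by (simp add: symmetric_op_def)
  show "S = T"
  proof (rule bounded_op_eqI[OF _ T])
    fix g
    assume g: "g \<in> ell2 V"
    have in_ell2: "S g \<in> ell2 V" "T g \<in> ell2 V"
      using S T g by (auto intro: bounded_op_in)
    have "ell2_inner V f (S g) = ell2_inner V f (T g)" if "f \<in> ell2 V" for f
      using S assms that g by (auto simp: symmetric_op_def)
    then have "ell2_inner V (\<lambda>x. S g x - T g x) (\<lambda>x. S g x - T g x) = 0"
      using in_ell2 by (simp add: ell2_inner_diff_right)
    then have "ell2_norm V (\<lambda>x. S g x - T g x) = 0"
      using ell2_inner_self[OF ell2_diff[OF in_ell2]] by simp
    then show "S g = T g"
      by (rule ell2_eqI[OF in_ell2])
  qed (use S in simp)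
qed

text \<open>The form of the square at \<open>f\<close> is the squared norm of
  \<open>T f\<close>.\<close>

lemma symmetric_square_positive:
  assumes "symmetric_op V T"
  shows "positive_op V (compose (ell2 V) T T)"
proof -
  have T: "bounded_op V T"
    using assms by (simp add: symmetric_op_def)
  show ?thesis
    unfolding positive_op_def
    using bounded_op_compose[OF T T]
    by (auto simp: compose_def symmetric_opD[OF assms] bounded_op_in[OF T] ell2_inner_self)
qed

lemma abs_op_symmetric:
  assumes "symmetric_op V T"
  shows "positive_op V (abs_op V T)"
    and "f \<in> ell2 V \<Longrightarrow> abs_op V T (abs_op V T f) = T (T f)"
proof -
  note sqrt = sqrt_op[OF symmetric_square_positive[OF assms]]
  have abs: "abs_op V T = sqrt_op V (compose (ell2 V) T T)"
    by (simp add: abs_op_def adjoint_op_symmetric[OF assms])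
  show "positive_op V (abs_op V T)"
    unfolding abs by (rule sqrt(1))
  show "abs_op V T (abs_op V T f) = T (T f)" if "f \<in> ell2 V"
    unfolding abs using fun_cong[OF sqrt(2), of f] that by (simp add: compose_def)
qed

text \<open>Two applications of Cauchy-Schwarz: first for the form of \<open>S\<close> at
  \<open>f\<close> and \<open>S f\<close>, then for the inner product of \<open>S (S f)\<close> and
  \<open>S f\<close>, which is the third moment.\<close>

lemma positive_op_moments:
  assumes S: "positive_op V S" and f: "f \<in> ell2 V"
  shows "(ell2_norm V (S f)) ^ 4 \<le>
    Re (ell2_inner V (S f) f) * (ell2_norm V (S (S f)) * ell2_norm V (S f))"
proof -
  have Sf: "S f \<in> ell2 V" and SSf: "S (S f) \<in> ell2 V"
    using f bounded_op_in[OF positive_op_bounded[OF S]] by auto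
  have "(ell2_norm V (S f)) ^ 4 = (cmod (ell2_inner V (S f) (S f)))\<^sup>2"
    by (simp add: ell2_inner_self[OF Sf] norm_power)
  also have "\<dots> \<le> Re (ell2_inner V (S f) f) * Re (ell2_inner V (S (S f)) (S f))"
    by (rule positive_op_Cauchy_Schwarz[OF S f Sf])
  also have "\<dots> \<le> Re (ell2_inner V (S f) f) * (ell2_norm V (S (S f)) * ell2_norm V (S f))"
    by (intro mult_left_mono positive_op_form[OF S f]
        order_trans[OF complex_Re_le_cmod ell2_Cauchy_Schwarz[OF SSf Sf]])
  finally show ?thesis .
qed

section \<open>Density of finitely supported functions\<close>

lemma ell2_inner_sum_left:
  assumes "\<And>i. i \<in> I \<Longrightarrow> u i \<in> ell2 V" "g \<in> ell2 V"
  shows "ell2_inner V (\<lambda>x. \<Sum>i\<in>I. u i x) g = (\<Sum>i\<in>I. ell2_inner V (u i) g)"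
  using assms(1)
proof (induction I rule: infinite_finite_induct)
  case (insert i I)
  then have "ell2_inner V (\<lambda>x. u i x + (\<Sum>i\<in>I. u i x)) g =
      ell2_inner V (u i) g + ell2_inner V (\<lambda>x. \<Sum>i\<in>I. u i x) g"
    by (intro ell2_inner_add_left assms(2) ell2_sum) auto
  with insert show ?case
    by simp
qed (simp_all add: ell2_inner_def)

lemma ell2_inner_delta_left:
  assumes "x \<in> V"
  shows "ell2_inner V (delta x) g = cnj (g x)"
proof -
  have "ell2_inner V (delta x) g = (\<Sum>\<^sub>\<infinity>y\<in>{x}. delta x y * cnj (g y))"
    unfolding ell2_inner_def using assms by (intro infsum_cong_neutral) (auto simp: delta_def)
  then show ?thesis
    by (simp add: delta_def)
qed

lemma ell2_inner_delta_right: "x \<in> V \<Longrightarrow> ell2_inner V f (delta x) = f x"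
  by (subst ell2_inner_commute) (simp add: ell2_inner_delta_left)

lemma ell2_norm_delta:
  assumes "x \<in> V"
  shows "ell2_norm V (delta x) = 1"
proof -
  have "complex_of_real ((ell2_norm V (delta x))\<^sup>2) = delta x x"
    using assms by (simp only: ell2_inner_self[symmetric] delta_in_ell2 ell2_inner_delta_right)
  then have "(ell2_norm V (delta x))\<^sup>2 = 1"
    by (simp only: delta_def of_real_eq_1_iff simp_thms if_True)
  then show ?thesis
    using ell2_norm_nonneg[of V "delta x"] by (auto simp: power2_eq_1_iff)
qed

text \<open>Truncate \<open>f\<close> to finite sets. The squared error is the mass outside
  \<open>F n\<close>, made at most \<open>(1 / real (Suc n))\<^sup>2\<close>; a sequence is produced
  so that the limit lemmas apply.\<close>

lemma ell2_finite_support_dense: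
  assumes f: "f \<in> ell2 V"
  obtains F where "\<And>n. finite (F n)" "\<And>n. F n \<subseteq> V"
    "(\<lambda>n. ell2_norm V (\<lambda>y. (\<Sum>x\<in>F n. f x * delta x y) - f y)) \<longlonglongrightarrow> 0"
proof -
  let ?h = "\<lambda>x. (cmod (f x))\<^sup>2"
  have "\<exists>F. finite F \<and> F \<subseteq> V \<and> dist (sum ?h F) (infsum ?h V) \<le> (1 / real (Suc n))\<^sup>2" for n
    by (rule infsum_finite_approximation[OF ell2_summable[OF f]]) simp
  then obtain F where F: "\<And>n. finite (F n)" "\<And>n. F n \<subseteq> V"
    "\<And>n. dist (sum ?h (F n)) (infsum ?h V) \<le> (1 / real (Suc n))\<^sup>2"
    by metis
  have bound: "ell2_norm V (\<lambda>y. (\<Sum>x\<in>F n. f x * delta x y) - f y) \<le> 1 / real (Suc n)" for n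
  proof -
    have trunc: "(\<Sum>x\<in>F n. f x * delta x y) - f y = (if y \<in> F n then 0 else - f y)" for y
      using F(1)[of n] by (simp add: delta_def if_distrib[of "\<lambda>z. _ * z"] cong: if_cong)
    have "(ell2_norm V (\<lambda>y. (\<Sum>x\<in>F n. f x * delta x y) - f y))\<^sup>2 = infsum ?h (V - F n)"
      unfolding ell2_norm_power2 trunc by (rule infsum_cong_neutral) auto
    also have "\<dots> = infsum ?h V - sum ?h (F n)"
      using F(1,2)[of n] ell2_summable[OF f] by (simp add: infsum_Diff)
    also have "\<dots> \<le> (1 / real (Suc n))\<^sup>2"
      using F(3)[of n] unfolding dist_real_def by linarith
    finally show ?thesis
      by (rule power2_le_imp_le) simp
  qed
  have "(\<lambda>n. ell2_norm V (\<lambda>y. (\<Sum>x\<in>F n. f x * delta x y) - f y)) \<longlonglongrightarrow> 0"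
    by (rule Lim_null_comparison[OF always_eventually lim_1_over_n[THEN LIMSEQ_Suc]])
      (use bound in simp)
  with F(1,2) show thesis
    by (rule that)
qed

text \<open>By linearity the operators agree on finite combinations of basis vectors, and by density
  and continuity everywhere. This is the uniqueness needed for \<open>adjacency_op\<close>.\<close>

lemma bounded_op_eq_on_delta:
  assumes S: "bounded_op V S" and T: "bounded_op V T" and eq: "\<And>x. x \<in> V \<Longrightarrow> S (delta x) = T (delta x)"
  shows "S = T"
proof (rule bounded_op_eqI[OF S T])
  fix f
  assume f: "f \<in> ell2 V"
  obtain F where F: "\<And>n. finite (F n)" "\<And>n. F n \<subseteq> V"
    and lim: "(\<lambda>n. ell2_norm V (\<lambda>y. (\<Sum>x\<in>F n. f x * delta x y) - f y)) \<longlonglongrightarrow> 0"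
    using ell2_finite_support_dense[OF f] by blast
  let ?u = "\<lambda>n y. \<Sum>x\<in>F n. f x * delta x y"
  have terms: "(\<lambda>y. f x * delta x y) \<in> ell2 V" if "x \<in> F n" for x n
    using that F(2) by (auto intro!: ell2_scale delta_in_ell2)
  then have u: "?u n \<in> ell2 V" for n
    by (intro ell2_sum)
  have "S (\<lambda>y. f x * delta x y) = T (\<lambda>y. f x * delta x y)" if "x \<in> F n" for x n
  proof -
    have "x \<in> V"
      using that F(2) by auto
    then show ?thesis
      using bounded_op_scale[OF S, of "delta x"] bounded_op_scale[OF T, of "delta x"] eq by simp
  qed
  then have "S (?u n) = T (?u n)" for n
    using bounded_op_sum[OF S, of "F n"] bounded_op_sum[OF T, of "F n"] terms by simp
  moreover have S_lim: "(\<lambda>n. S (?u n) x) \<longlonglongrightarrow> S f x" for x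
    by (rule ell2_norm_limit_pointwise[OF bounded_op_in[OF S u] bounded_op_in[OF S f]
          bounded_op_norm_limit[OF S u f lim]])
  moreover have "(\<lambda>n. T (?u n) x) \<longlonglongrightarrow> T f x" for x
    by (rule ell2_norm_limit_pointwise[OF bounded_op_in[OF T u] bounded_op_in[OF T f]
          bounded_op_norm_limit[OF T u f lim]])
  ultimately have "(\<lambda>n. S (?u n) x) \<longlonglongrightarrow> T f x" for x
    by simp
  then show "S f = T f"
    by (intro ext LIMSEQ_unique[OF S_lim])
qed

section \<open>The adjacency operator\<close>

locale bounded_degree_graph =
  fixes V :: "'a set" and E :: "'a set set" and K :: nat
  assumes simple: "simple_graph V E"
    and finite_neighbours_in: "\<And>x. x \<in> V \<Longrightarrow> finite (neighbours E x)"
    and degree_le: "\<And>x. x \<in> V \<Longrightarrow> vertex_degree E x \<le> K"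
begin

lemma neighbours_subset: "neighbours E x \<subseteq> V"
  using simple by (auto simp: neighbours_def simple_graph_def)

text \<open>Finiteness and the degree bound are assumed on \<open>V\<close> only; having no edges
  elsewhere extends both to every \<open>x\<close>.\<close>

lemma neighbours_outside: "x \<notin> V \<Longrightarrow> neighbours E x = {}"
  using simple by (auto simp: neighbours_def simple_graph_def)

lemma neighbours_sym: "y \<in> neighbours E x \<longleftrightarrow> x \<in> neighbours E y"
  by (simp add: neighbours_def insert_commute)

lemma finite_neighbours [simp]: "finite (neighbours E x)"
  using finite_neighbours_in neighbours_outside by (cases "x \<in> V") auto

lemma card_neighbours_le: "card (neighbours E x) \<le> K"
  using degree_le neighbours_outside by (cases "x \<in> V") (auto simp: vertex_degree_def)

text \<open>A pointwise formula that makes sense for every function: it gathers values at the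
  neighbours of \<open>y\<close>, whereas the basis description spreads \<open>delta x\<close> over
  the neighbours of \<open>x\<close>. Symmetry of adjacency reconciles the two in
  \<open>adj_delta\<close>.\<close>

definition adj :: "('a \<Rightarrow> complex) \<Rightarrow> ('a \<Rightarrow> complex)" where
  "adj f = (\<lambda>y. \<Sum>x\<in>neighbours E y. f x)"

text \<open>A Schur test: Cauchy-Schwarz on each neighbourhood costs one factor \<open>K\<close>,
  and each vertex is counted for at most \<open>K\<close> vertices \<open>y\<close>, which costs the
  other.\<close>

lemma adj_finite_sum_le:
  assumes f: "f \<in> ell2 V" and F: "finite F" "F \<subseteq> V"
  shows "(\<Sum>y\<in>F. (cmod (adj f y))\<^sup>2) \<le> (real K * ell2_norm V f)\<^sup>2"
proof -
  \<comment> \<open>A finite set containing every neighbour involved, so that the double sum can be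
    swapped as a finite one.\<close>
  define G where "G = (\<Union>y\<in>F. neighbours E y)"
  have G: "finite G" "G \<subseteq> V"
    using F neighbours_subset by (auto simp: G_def)
  have "(cmod (adj f y))\<^sup>2 \<le> real K * (\<Sum>x\<in>neighbours E y. (cmod (f x))\<^sup>2)" for y
  proof -
    have "(cmod (adj f y))\<^sup>2 \<le> (\<Sum>x\<in>neighbours E y. cmod (f x))\<^sup>2"
      unfolding adj_def by (intro power_mono norm_sum) simp
    also have "\<dots> \<le> (\<Sum>x\<in>neighbours E y. (cmod (f x))\<^sup>2) * real (card (neighbours E y))"
      by (rule sum_squared_le_sum_of_squares)
    also have "\<dots> \<le> (\<Sum>x\<in>neighbours E y. (cmod (f x))\<^sup>2) * real K"
      by (intro mult_left_mono sum_nonneg) (auto simp: card_neighbours_le)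
    finally show ?thesis
      by (simp add: mult.commute)
  qed
  then have "(\<Sum>y\<in>F. (cmod (adj f y))\<^sup>2) \<le>
      (\<Sum>y\<in>F. real K * (\<Sum>x\<in>neighbours E y. (cmod (f x))\<^sup>2))"
    by (rule sum_mono)
  also have "\<dots> = real K * (\<Sum>y\<in>F. \<Sum>x\<in>{x \<in> G. x \<in> neighbours E y}. (cmod (f x))\<^sup>2)"
    unfolding sum_distrib_left[symmetric]
    by (intro arg_cong[where f = "(*) _"] sum.cong) (auto simp: G_def)
  also have "\<dots> = real K * (\<Sum>x\<in>G. \<Sum>y\<in>{y \<in> F. x \<in> neighbours E y}. (cmod (f x))\<^sup>2)"
    by (simp only: sum.swap_restrict[OF F(1) G(1)])
  also have "\<dots> \<le> real K * (\<Sum>x\<in>G. real K * (cmod (f x))\<^sup>2)"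
  proof (intro mult_left_mono sum_mono)
    fix x
    have "card {y \<in> F. x \<in> neighbours E y} \<le> card (neighbours E x)"
      by (intro card_mono) (auto simp: neighbours_sym)
    then show "(\<Sum>y\<in>{y \<in> F. x \<in> neighbours E y}. (cmod (f x))\<^sup>2) \<le> real K * (cmod (f x))\<^sup>2"
      using card_neighbours_le[of x] by (simp add: mult_right_mono)
  qed simp
  also have "\<dots> = (real K)\<^sup>2 * (\<Sum>x\<in>G. (cmod (f x))\<^sup>2)"
    by (simp add: sum_distrib_left power2_eq_square mult.assoc)
  also have "\<dots> \<le> (real K)\<^sup>2 * (ell2_norm V f)\<^sup>2"
    unfolding ell2_norm_power2
    by (intro mult_left_mono finite_sum_le_infsum ell2_summable f G) auto
  finally show ?thesis
    by (simp add: power_mult_distrib)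
qed

lemma
  assumes f: "f \<in> ell2 V"
  shows adj_in: "adj f \<in> ell2 V" and adj_norm: "ell2_norm V (adj f) \<le> real K * ell2_norm V f"
proof -
  have summable: "(\<lambda>y. (cmod (adj f y))\<^sup>2) summable_on V"
    by (rule nonneg_bdd_above_summable_on)
      (use adj_finite_sum_le[OF f] in \<open>auto intro!: bdd_aboveI2[where M = "(real K * ell2_norm V f)\<^sup>2"]\<close>)
  then show "adj f \<in> ell2 V"
    by (simp add: ell2_def adj_def neighbours_outside)
  have "(ell2_norm V (adj f))\<^sup>2 \<le> (real K * ell2_norm V f)\<^sup>2"
    unfolding ell2_norm_power2 by (rule infsum_le_finite_sums[OF summable adj_finite_sum_le[OF f]])
  then show "ell2_norm V (adj f) \<le> real K * ell2_norm V f"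
    by (rule power2_le_imp_le) simp
qed

lemma adj_delta: "adj (delta x) = (\<lambda>y. \<Sum>x'\<in>neighbours E x. delta x' y)"
  by (rule ext) (auto simp: adj_def delta_def neighbours_sym[of x])

lemma adj_bounded: "bounded_op V (restrict adj (ell2 V))"
  by (rule bounded_opI[OF adj_in _ _ adj_norm]) (auto simp: adj_def sum.distrib sum_distrib_left)

lemma adjacency_op_eq: "adjacency_op V E = restrict adj (ell2 V)"
  unfolding adjacency_op_def
proof (rule the_equality)
  show "bounded_op V (restrict adj (ell2 V)) \<and>
      (\<forall>x\<in>V. restrict adj (ell2 V) (delta x) = (\<lambda>y. \<Sum>x'\<in>neighbours E x. delta x' y))"
    using adj_bounded by (simp add: adj_delta)
next
  fix A
  assume "bounded_op V A \<and> (\<forall>x\<in>V. A (delta x) = (\<lambda>y. \<Sum>x'\<in>neighbours E x. delta x' y))"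
  then show "A = restrict adj (ell2 V)"
    using adj_bounded by (intro bounded_op_eq_on_delta) (auto simp: adj_delta)
qed

lemma adjacency_op_apply: "f \<in> ell2 V \<Longrightarrow> adjacency_op V E f = adj f"
  by (simp add: adjacency_op_eq)

lemma adjacency_op_bounded: "bounded_op V (adjacency_op V E)"
  unfolding adjacency_op_eq by (rule adj_bounded)

text \<open>On \<open>delta x\<close> both sides are the sum of \<open>cnj (g y)\<close> over the
  neighbours \<open>y\<close> of \<open>x\<close>. Linearity and density extend this in
  \<open>f\<close>, while \<open>g\<close> stays arbitrary throughout.\<close>

lemma adjacency_op_symmetric: "symmetric_op V (adjacency_op V E)"
proof -
  have "ell2_inner V (adj f) g = ell2_inner V f (adj g)" if f: "f \<in> ell2 V" and g: "g \<in> ell2 V" for f g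
  proof -
    obtain F where F: "\<And>n. finite (F n)" "\<And>n. F n \<subseteq> V"
      and lim: "(\<lambda>n. ell2_norm V (\<lambda>y. (\<Sum>x\<in>F n. f x * delta x y) - f y)) \<longlonglongrightarrow> 0"
      using ell2_finite_support_dense[OF f] by blast
    let ?u = "\<lambda>n y. \<Sum>x\<in>F n. f x * delta x y"
    have terms: "(\<lambda>y. f x * delta x y) \<in> ell2 V" "delta x \<in> ell2 V" "x \<in> V" if "x \<in> F n" for x n
      using that F(2) by (auto intro!: ell2_scale delta_in_ell2)
    then have u: "?u n \<in> ell2 V" for n
      by (intro ell2_sum)
    have delta: "ell2_inner V (adj (delta x)) g = ell2_inner V (delta x) (adj g)" if x: "x \<in> V" for x
    proof -
      have "ell2_inner V (adj (delta x)) g = (\<Sum>x'\<in>neighbours E x. cnj (g x'))"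
        unfolding adj_delta using neighbours_subset
        by (subst ell2_inner_sum_left) (auto intro!: sum.cong ell2_inner_delta_left delta_in_ell2 g)
      then show ?thesis
        by (simp add: ell2_inner_delta_left[OF x] adj_def)
    qed
    have "ell2_inner V (adj (?u n)) g = ell2_inner V (?u n) (adj g)" for n
    proof -
      have "adj (?u n) = (\<lambda>y. \<Sum>x\<in>F n. f x * adj (delta x) y)"
        unfolding adj_def sum_distrib_left by (rule ext) (rule sum.swap)
      then show ?thesis
        using terms by (simp add: ell2_inner_sum_left ell2_inner_scale_left adj_in g delta)
    qed
    moreover have "(\<lambda>n. ell2_inner V (?u n) (adj g)) \<longlonglongrightarrow> ell2_inner V f (adj g)"
      by (intro ell2_norm_limit_inner u f adj_in g lim)
    moreover have "(\<lambda>n. ell2_inner V (adj (?u n)) g) \<longlonglongrightarrow> ell2_inner V (adj f) g"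
      using bounded_op_norm_limit[OF adjacency_op_bounded u f lim]
      by (intro ell2_norm_limit_inner u f adj_in g) (simp add: adjacency_op_apply u f)
    ultimately show ?thesis
      using LIMSEQ_unique by auto
  qed
  then show ?thesis
    using adjacency_op_bounded by (simp add: symmetric_op_def adjacency_op_apply)
qed

text \<open>By symmetry the squared norm is the diagonal entry of the squared operator, which counts
  closed walks of length 2 at \<open>x\<close>: one through each neighbour.\<close>

lemma norm_adjacency_delta:
  assumes "x \<in> V"
  shows "(ell2_norm V (adjacency_op V E (delta x)))\<^sup>2 = real (vertex_degree E x)"
proof -
  let ?A = "adjacency_op V E"
  have Ad: "?A (delta x) \<in> ell2 V"
    using assms by (intro bounded_op_in[OF adjacency_op_bounded]) simp
  have "complex_of_real ((ell2_norm V (?A (delta x)))\<^sup>2) = ell2_inner V (?A (?A (delta x))) (delta x)"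
    using symmetric_opD[OF adjacency_op_symmetric Ad, of "delta x"] ell2_inner_self[OF Ad] assms
    by simp
  also have "\<dots> = adj (adj (delta x)) x"
    using assms by (simp add: ell2_inner_delta_right adjacency_op_apply adj_in)
  also have "\<dots> = (\<Sum>y\<in>neighbours E x. 1)"
    by (subst adj_def, rule sum.cong) (auto simp: adj_delta, simp add: delta_def neighbours_sym[of x])
  also have "\<dots> = complex_of_real (real (vertex_degree E x))"
    by (simp add: vertex_degree_def)
  finally show ?thesis
    by (simp only: of_real_eq_iff)
qed

end

section \<open>The energy of a vertex\<close>

theorem theorem7p1:
  fixes V :: "'a set" and E :: "'a set set" and v :: 'a
  assumes "countable V"
    and "simple_graph V E"
    and "uniformly_locally_finite V E"
    and "v \<in> V"
  shows "real (vertex_degree E v) powr (3/2) / sqrt (M4 V E v) \<le> vertex_energy V E v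
       \<and> vertex_energy V E v \<le> sqrt (real (vertex_degree E v))"
proof -
  obtain K where "\<forall>x\<in>V. finite (neighbours E x) \<and> vertex_degree E x \<le> K"
    using assms(3) by (auto simp: uniformly_locally_finite_def)
  then interpret bounded_degree_graph V E K
    using assms(2) by unfold_locales auto
  define A S d where "A = adjacency_op V E" and "S = abs_op V A" and "d = (delta v :: 'a \<Rightarrow> complex)"
  define m where "m = vertex_energy V E v"
  define r where "r = sqrt (real (vertex_degree E v))"
  define q where "q = sqrt (M4 V E v)"
  have sym: "symmetric_op V A"
    unfolding A_def by (rule adjacency_op_symmetric)
  have S: "positive_op V S" and SS: "\<And>f. f \<in> ell2 V \<Longrightarrow> S (S f) = A (A f)"
    using abs_op_symmetric[OF sym] by (simp_all add: S_def)
  have d [simp]: "d \<in> ell2 V"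
    using assms(4) by (simp add: d_def)
  have norm_d: "ell2_norm V d = 1"
    unfolding d_def by (rule ell2_norm_delta[OF assms(4)])
  note A_in [simp] = bounded_op_in[OF adjacency_op_bounded, folded A_def]
  have Sd [simp]: "S d \<in> ell2 V"
    by (rule bounded_op_in[OF positive_op_bounded[OF S] d])
  have m: "m = Re (ell2_inner V (S d) d)"
    by (simp add: m_def vertex_energy_def S_def A_def d_def)
  have m0: "0 \<le> m"
    unfolding m by (rule positive_op_form[OF S d])
  have norm_A: "ell2_norm V (A d) = r"
    using norm_adjacency_delta[OF assms(4)] by (simp add: r_def A_def d_def real_sqrt_unique)
  \<comment> \<open>Both sides are the second moment, since \<open>S\<close> and \<open>A\<close>
    are symmetric with equal squares.\<close>
  have "ell2_inner V (S d) (S d) = ell2_inner V (A d) (A d)"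
    using symmetric_opD[OF positive_op_symmetric[OF S] d Sd] symmetric_opD[OF sym d, of "A d"]
    by (simp add: SS)
  then have norm_S: "ell2_norm V (S d) = r"
    by (simp add: ell2_inner_self norm_A[symmetric] flip: of_real_power)
  \<comment> \<open>Moving two factors across identifies the fourth moment with the squared norm of
    \<open>A (A d)\<close>, which equals \<open>S (S d)\<close>. Hence \<open>q\<close> is the norm
    of \<open>S (S d)\<close>.\<close>
  have "ell2_inner V (A (A (A (A d)))) d = ell2_inner V (A (A d)) (A (A d))"
    by (simp add: symmetric_opD[OF sym])
  then have "M4 V E v = (ell2_norm V (A (A d)))\<^sup>2"
    by (simp add: M4_def numeral_eq_Suc ell2_inner_self flip: A_def d_def)
  then have q: "ell2_norm V (S (S d)) = q"
    by (simp add: q_def SS)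
  have upper: "m \<le> r"
    using order_trans[OF complex_Re_le_cmod ell2_Cauchy_Schwarz[OF Sd d]]
    by (simp add: m norm_S norm_d)
  have r0: "0 \<le> r" and q0: "0 \<le> q"
    using norm_S q ell2_norm_nonneg by metis+
  have "r ^ 3 * r \<le> (m * q) * r"
    using positive_op_moments[OF S d] by (simp add: norm_S q m[symmetric] power_numeral_reduce mult_ac)
  \<comment> \<open>Cancels \<open>r\<close>; at an isolated vertex \<open>r = 0\<close> and the
    claim is just \<open>0 \<le> m * q\<close>.\<close>
  then have "r ^ 3 \<le> m * q"
    using r0 m0 q0 by (cases "r = 0") (auto simp: mult_le_cancel_right)
  \<comment> \<open>For \<open>q = 0\<close> the quotient is 0 by convention, so nonnegativity of
    \<open>m\<close> suffices.\<close>
  then have "r ^ 3 / q \<le> m"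
    using q0 m0 by (cases "q = 0") (auto simp: divide_le_eq)
  moreover have "real (vertex_degree E v) powr (3/2) = r ^ 3"
    by (simp add: r_def powr_half_sqrt_powr real_sqrt_power)
  ultimately show ?thesis
    using upper unfolding m_def q_def r_def by simp
qed

end
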